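(* Let $(I,\mathcal A,\mu)$ be a charge space and $M$ an $\mathcal A$-meanable $L$-structure. Then for every affine $L$-formula $\phi(x_1,\dots,x_n)$ and all $[a^1_i],\dots,[a^n_i]\in M^\mu$, $$\phi^{M^{\mu}}([a^1_i],\dots,[a^n_i])=\int\phi^M(a^1_i,\dots,a^n_i)\,d\mu .$$
   Context: Affine continuous logic: $L$ a Lipschitz language; $L$-structures are complete metric spaces of diameter $\le1$ with Lipschitz interpretations; affine formulas are built from atomic $1,d(t_1,t_2),R(\bar t)$ by $+$, real scalars, $\sup$, $\inf$. A charge space $(I,\mathcal A,\mu)$: $\mathcal A$ is a Boolean algebra of subsets of $I$ and $\mu:\mathcal A\to[0,1]$ is finitely additive with $\mu(I)=1$; integrals of bounded $\mathcal A$-measurable real functions are with respect to $\mu$. The weight $w(M)$ is the least cardinality of a base of the topology of $M$, plus $\aleph_0$. $M$ is $\mathcal A$-meanable if $M$ is finite or $\mathcal A$ is closed under intersections of at most $w(M)$ many members. A map $a:I\to M$ is measurable if $a^{-1}(B)\in\mathcal A$ for every Borel $B\subseteq M$. $M^\mu$ is the set of classes $[a_i]$ of measurable maps $a=(a_i):I\to M$ modulo $\int d(a_i,b_i)d\mu=0$, with metric $d([a_i],[b_i])=\int d(a_i,b_i)d\mu$, $c^{M^\mu}=[c^M]$, $F^{M^\mu}([a_i],\dots)=[F^M(a_i,\dots)]$, $R^{M^\mu}([a_i],\dots)=\int R^M(a_i,\dots)d\mu$. *)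

theory Defs
  imports "HOL-Analysis.Analysis"
begin

text \<open>A Lipschitz language: function symbols of type 'f (constants are the
0-ary function symbols) and relation symbols of type 'r, each with an arity
and a Lipschitz constant.\<close>

record ('f, 'r) lang =
  farity :: "'f \<Rightarrow> nat"
  rarity :: "'r \<Rightarrow> nat"
  flip   :: "'f \<Rightarrow> real"
  rlip   :: "'r \<Rightarrow> real"

record ('a, 'f, 'r) struc =
  scarrier :: "'a set"
  sdist    :: "'a \<Rightarrow> 'a \<Rightarrow> real"
  sfun     :: "'f \<Rightarrow> 'a list \<Rightarrow> 'a"
  srel     :: "'r \<Rightarrow> 'a list \<Rightarrow> real"

definition tdist :: "('a \<Rightarrow> 'a \<Rightarrow> real) \<Rightarrow> 'a list \<Rightarrow> 'a list \<Rightarrow> real" where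
  "tdist d xs ys = (\<Sum>k<length xs. d (xs ! k) (ys ! k))"

definition is_Lstructure :: "('f, 'r, 'z) lang_scheme \<Rightarrow> ('a, 'f, 'r, 'w) struc_scheme \<Rightarrow> bool" where
  "is_Lstructure L M \<longleftrightarrow>
     Metric_space (scarrier M) (sdist M) \<and>
     Metric_space.mcomplete (scarrier M) (sdist M) \<and>
     scarrier M \<noteq> {} \<and>
     (\<forall>x\<in>scarrier M. \<forall>y\<in>scarrier M. sdist M x y \<le> 1) \<and>
     (\<forall>F xs. set xs \<subseteq> scarrier M \<and> length xs = farity L F \<longrightarrow> sfun M F xs \<in> scarrier M) \<and>
     (\<forall>F xs ys. set xs \<subseteq> scarrier M \<and> set ys \<subseteq> scarrier M \<and>
         length xs = farity L F \<and> length ys = farity L F \<longrightarrow>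
         sdist M (sfun M F xs) (sfun M F ys) \<le> flip L F * tdist (sdist M) xs ys) \<and>
     (\<forall>R xs ys. set xs \<subseteq> scarrier M \<and> set ys \<subseteq> scarrier M \<and>
         length xs = rarity L R \<and> length ys = rarity L R \<longrightarrow>
         \<bar>srel M R xs - srel M R ys\<bar> \<le> rlip L R * tdist (sdist M) xs ys)"

datatype 'f trm = TVar nat | TFun 'f "'f trm list"

datatype ('f, 'r) afm =
    AOne
  | ADist "'f trm" "'f trm"
  | ARel 'r "'f trm list"
  | AAdd "('f, 'r) afm" "('f, 'r) afm"
  | AScale real "('f, 'r) afm"
  | ASup nat "('f, 'r) afm"
  | AInf nat "('f, 'r) afm"

fun wf_trm :: "('f, 'r, 'z) lang_scheme \<Rightarrow> 'f trm \<Rightarrow> bool" where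
  "wf_trm L (TVar k) = True"
| "wf_trm L (TFun F ts) = (length ts = farity L F \<and> (\<forall>t\<in>set ts. wf_trm L t))"

fun wf_afm :: "('f, 'r, 'z) lang_scheme \<Rightarrow> ('f, 'r) afm \<Rightarrow> bool" where
  "wf_afm L AOne = True"
| "wf_afm L (ADist s t) = (wf_trm L s \<and> wf_trm L t)"
| "wf_afm L (ARel R ts) = (length ts = rarity L R \<and> (\<forall>t\<in>set ts. wf_trm L t))"
| "wf_afm L (AAdd p q) = (wf_afm L p \<and> wf_afm L q)"
| "wf_afm L (AScale c p) = wf_afm L p"
| "wf_afm L (ASup x p) = wf_afm L p"
| "wf_afm L (AInf x p) = wf_afm L p"

fun fv_trm :: "'f trm \<Rightarrow> nat set" where
  "fv_trm (TVar k) = {k}"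
| "fv_trm (TFun F ts) = (\<Union>t\<in>set ts. fv_trm t)"

fun fv_afm :: "('f, 'r) afm \<Rightarrow> nat set" where
  "fv_afm AOne = {}"
| "fv_afm (ADist s t) = fv_trm s \<union> fv_trm t"
| "fv_afm (ARel R ts) = (\<Union>t\<in>set ts. fv_trm t)"
| "fv_afm (AAdd p q) = fv_afm p \<union> fv_afm q"
| "fv_afm (AScale c p) = fv_afm p"
| "fv_afm (ASup x p) = fv_afm p - {x}"
| "fv_afm (AInf x p) = fv_afm p - {x}"

fun teval :: "('a, 'f, 'r, 'w) struc_scheme \<Rightarrow> 'f trm \<Rightarrow> (nat \<Rightarrow> 'a) \<Rightarrow> 'a" where
  "teval M (TVar k) v = v k"
| "teval M (TFun F ts) v = sfun M F (map (\<lambda>t. teval M t v) ts)"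

fun aeval :: "('a, 'f, 'r, 'w) struc_scheme \<Rightarrow> ('f, 'r) afm \<Rightarrow> (nat \<Rightarrow> 'a) \<Rightarrow> real" where
  "aeval M AOne v = 1"
| "aeval M (ADist s t) v = sdist M (teval M s v) (teval M t v)"
| "aeval M (ARel R ts) v = srel M R (map (\<lambda>t. teval M t v) ts)"
| "aeval M (AAdd p q) v = aeval M p v + aeval M q v"
| "aeval M (AScale c p) v = c * aeval M p v"
| "aeval M (ASup x p) v = (SUP c\<in>scarrier M. aeval M p (v(x := c)))"
| "aeval M (AInf x p) v = (INF c\<in>scarrier M. aeval M p (v(x := c)))"

definition charge_space :: "'i set \<Rightarrow> 'i set set \<Rightarrow> ('i set \<Rightarrow> real) \<Rightarrow> bool" where
  "charge_space I A \<mu> \<longleftrightarrow>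
     algebra I A \<and>
     (\<forall>E\<in>A. 0 \<le> \<mu> E \<and> \<mu> E \<le> 1) \<and>
     \<mu> I = 1 \<and>
     (\<forall>E\<in>A. \<forall>F\<in>A. E \<inter> F = {} \<longrightarrow> \<mu> (E \<union> F) = \<mu> E + \<mu> F)"

definition partitions :: "'i set \<Rightarrow> 'i set set \<Rightarrow> 'i set set set" where
  "partitions I A = {P. finite P \<and> P \<subseteq> A \<and> {} \<notin> P \<and> \<Union>P = I \<and>
       (\<forall>E\<in>P. \<forall>F\<in>P. E \<noteq> F \<longrightarrow> E \<inter> F = {})}"

text \<open>Integral of a bounded A-measurable function with respect to the charge mu
(supremum of lower sums; for bounded measurable functions this is the usual
integral).\<close>
definition chint :: "'i set \<Rightarrow> 'i set set \<Rightarrow> ('i set \<Rightarrow> real) \<Rightarrow> ('i \<Rightarrow> real) \<Rightarrow> real" where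
  "chint I A \<mu> f = (SUP P\<in>partitions I A. \<Sum>E\<in>P. \<mu> E * (INF i\<in>E. f i))"

definition open_sets :: "('a, 'f, 'r, 'w) struc_scheme \<Rightarrow> 'a set set" where
  "open_sets M = {U. openin (Metric_space.mtopology (scarrier M) (sdist M)) U}"

definition is_base :: "('a, 'f, 'r, 'w) struc_scheme \<Rightarrow> 'a set set \<Rightarrow> bool" where
  "is_base M B \<longleftrightarrow> B \<subseteq> open_sets M \<and> (\<forall>U\<in>open_sets M. \<exists>C\<subseteq>B. U = \<Union>C)"

text \<open>|F| \<le> w(M), where w(M) = (least cardinality of a base) + aleph_0.\<close>
definition card_le_weight :: "('a, 'f, 'r, 'w) struc_scheme \<Rightarrow> 'b set \<Rightarrow> bool" where
  "card_le_weight M F \<longleftrightarrow>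
     countable F \<or> (\<forall>B. is_base M B \<longrightarrow> (\<exists>g. inj_on g F \<and> g ` F \<subseteq> B))"

definition meanable :: "'i set set \<Rightarrow> ('a, 'f, 'r, 'w) struc_scheme \<Rightarrow> bool" where
  "meanable A M \<longleftrightarrow> finite (scarrier M) \<or>
     (\<forall>F. F \<subseteq> A \<and> F \<noteq> {} \<and> card_le_weight M F \<longrightarrow> \<Inter>F \<in> A)"

definition borel_sets :: "('a, 'f, 'r, 'w) struc_scheme \<Rightarrow> 'a set set" where
  "borel_sets M = sigma_sets (scarrier M) (open_sets M)"

definition meas_map :: "'i set \<Rightarrow> 'i set set \<Rightarrow> ('a, 'f, 'r, 'w) struc_scheme \<Rightarrow> ('i \<Rightarrow> 'a) \<Rightarrow> bool" where
  "meas_map I A M a \<longleftrightarrow> a \<in> I \<rightarrow> scarrier M \<and> (\<forall>B\<in>borel_sets M. {i\<in>I. a i \<in> B} \<in> A)"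

definition mcls :: "'i set \<Rightarrow> 'i set set \<Rightarrow> ('i set \<Rightarrow> real) \<Rightarrow> ('a, 'f, 'r, 'w) struc_scheme
    \<Rightarrow> ('i \<Rightarrow> 'a) \<Rightarrow> ('i \<Rightarrow> 'a) set" where
  "mcls I A \<mu> M a = {b. meas_map I A M b \<and> chint I A \<mu> (\<lambda>i. sdist M (a i) (b i)) = 0}"

definition rep :: "('i \<Rightarrow> 'a) set \<Rightarrow> 'i \<Rightarrow> 'a" where
  "rep X = (SOME a. a \<in> X)"

definition power_struc :: "'i set \<Rightarrow> 'i set set \<Rightarrow> ('i set \<Rightarrow> real) \<Rightarrow> ('a, 'f, 'r, 'w) struc_scheme
    \<Rightarrow> (('i \<Rightarrow> 'a) set, 'f, 'r) struc" where
  "power_struc I A \<mu> M =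
     \<lparr> scarrier = {mcls I A \<mu> M a | a. meas_map I A M a},
       sdist = (\<lambda>X Y. chint I A \<mu> (\<lambda>i. sdist M (rep X i) (rep Y i))),
       sfun = (\<lambda>F Xs. mcls I A \<mu> M (\<lambda>i. sfun M F (map (\<lambda>X. rep X i) Xs))),
       srel = (\<lambda>R Xs. chint I A \<mu> (\<lambda>i. srel M R (map (\<lambda>X. rep X i) Xs))) \<rparr>"

end

theory Submission
  imports Defs
begin

text \<open>Measurable maps into M are the uniform limits of maps all of whose preimages lie in A: M has a
  dense subset D no larger than its weight, and A is closed under unions indexed by D. Tuples of
  D-valued maps of this kind are again of this kind, and every affine formula is Lipschitz on M, so
  formula values along measurable tuples are uniform limits of simple functions, on which the
  integral is linear and monotone. In the supremum step a near-optimal witness is chosen as a function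
  of a discrete approximation of the parameters, hence is measurable. An infimum is the negative of
  the supremum of the negative.\<close>

unbundle cardinal_syntax

text \<open>Two obstacles shape the proof. And measurability of the coordinates says little about a
  tuple, because in a non-separable M the Borel sets of M^n need not be generated by products of
  Borel sets. Approximation by countably many values can fail there as well, so the approximating
  maps take values in a possibly uncountable dense set whose size is matched to the closure of A.
  Lipschitz bounds do three jobs: they pass from the approximations to the maps themselves, they
  bound the integrands, and they make integrals independent of the representatives on which
  \<open>power_struc\<close> interprets the symbols.\<close>

definition osc_le :: "'i set set \<Rightarrow> ('i \<Rightarrow> real) \<Rightarrow> real \<Rightarrow> bool" where
  "osc_le P f e \<longleftrightarrow> (\<forall>E\<in>P. \<forall>i\<in>E. \<forall>j\<in>E. \<bar>f i - f j\<bar> \<le> e)"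

definition tag :: "'i set \<Rightarrow> 'i" where
  "tag E = (SOME i. i \<in> E)"

lemma tag_in: "E \<noteq> {} \<Longrightarrow> tag E \<in> E"
  unfolding tag_def by (rule someI_ex) blast

section \<open>Integration against a finitely additive charge\<close>

locale charge =
  fixes I :: "'i set" and A :: "'i set set" and \<mu> :: "'i set \<Rightarrow> real"
  assumes charge: "charge_space I A \<mu>"
begin

sublocale algebra I A
  using charge by (simp add: charge_space_def)

lemma mu_nonneg: "E \<in> A \<Longrightarrow> 0 \<le> \<mu> E"
  and mu_space: "\<mu> I = 1"
  and mu_Un: "E \<in> A \<Longrightarrow> F \<in> A \<Longrightarrow> E \<inter> F = {} \<Longrightarrow> \<mu> (E \<union> F) = \<mu> E + \<mu> F"
  using charge by (auto simp: charge_space_def)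

lemma mu_empty: "\<mu> {} = 0"
  using mu_Un[of "{}" "{}"] by simp

lemma space_nonempty: "I \<noteq> {}"
  using mu_empty mu_space by auto

text \<open>The union is indexed by P rather than taken over a set of sets, because the
  intersections \<open>E \<inter> F\<close> with a fixed F can be empty for several E and then
  coincide.\<close>

lemma mu_finite_UN:
  assumes "finite P" "\<And>E. E \<in> P \<Longrightarrow> g E \<in> A"
    and "\<And>E F. E \<in> P \<Longrightarrow> F \<in> P \<Longrightarrow> E \<noteq> F \<Longrightarrow> g E \<inter> g F = {}"
  shows "\<mu> (\<Union>E\<in>P. g E) = (\<Sum>E\<in>P. \<mu> (g E))"
  using assms
proof (induction P rule: finite_induct)
  case empty
  then show ?case by (simp add: mu_empty)
next
  case (insert E P)
  have "\<mu> (g E \<union> (\<Union>F\<in>P. g F)) = \<mu> (g E) + \<mu> (\<Union>F\<in>P. g F)"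
  proof (rule mu_Un)
    show "(\<Union>F\<in>P. g F) \<in> A"
      using insert by (intro finite_UN) auto
    have "g E \<inter> g F = {}" if "F \<in> P" for F
      using insert.prems(2)[of E F] insert.hyps that by auto
    then show "g E \<inter> (\<Union>F\<in>P. g F) = {}" by blast
  qed (use insert in auto)
  then show ?case using insert by simp
qed

lemma partition_in: "P \<in> partitions I A \<Longrightarrow> E \<in> P \<Longrightarrow> E \<in> A"
  and partition_nonempty: "P \<in> partitions I A \<Longrightarrow> E \<in> P \<Longrightarrow> E \<noteq> {}"
  and partition_finite: "P \<in> partitions I A \<Longrightarrow> finite P"
  and partition_Union: "P \<in> partitions I A \<Longrightarrow> \<Union>P = I"
  and partition_disjoint: "P \<in> partitions I A \<Longrightarrow> E \<in> P \<Longrightarrow> F \<in> P \<Longrightarrow> E \<noteq> F \<Longrightarrow> E \<inter> F = {}"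
  by (auto simp: partitions_def)

lemma partition_tag: "P \<in> partitions I A \<Longrightarrow> E \<in> P \<Longrightarrow> tag E \<in> E"
  by (simp add: partition_nonempty tag_in)

lemma partition_tag_space: "P \<in> partitions I A \<Longrightarrow> E \<in> P \<Longrightarrow> tag E \<in> I"
  using partition_tag partition_Union by blast

lemma trivial_partition: "{I} \<in> partitions I A"
  using space_nonempty by (auto simp: partitions_def)

lemma mu_partition:
  assumes P: "P \<in> partitions I A" and F: "F \<in> A"
  shows "\<mu> F = (\<Sum>E\<in>P. \<mu> (E \<inter> F))"
proof -
  have "F \<subseteq> \<Union>P" using sets_into_space[OF F] partition_Union[OF P] by simp
  then have "F = (\<Union>E\<in>P. E \<inter> F)" by blast
  also have "\<mu> \<dots> = (\<Sum>E\<in>P. \<mu> (E \<inter> F))"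
    using partition_disjoint[OF P]
    by (intro mu_finite_UN partition_finite[OF P] Int F partition_in[OF P]) blast+
  finally show ?thesis .
qed

lemma mu_partition_sum: "P \<in> partitions I A \<Longrightarrow> (\<Sum>E\<in>P. \<mu> E) = 1"
  using mu_partition[of P I] mu_space sets_into_space partition_in
  by (metis (no_types, lifting) Int_absorb2 sum.cong top)

lemma partition_refine:
  assumes P: "P \<in> partitions I A" and Q: "Q \<in> partitions I A"
  obtains R where "R \<in> partitions I A"
    "\<And>G. G \<in> R \<Longrightarrow> \<exists>E\<in>P. G \<subseteq> E" "\<And>G. G \<in> R \<Longrightarrow> \<exists>F\<in>Q. G \<subseteq> F"
proof
  let ?R = "(\<lambda>(E, F). E \<inter> F) ` (P \<times> Q) - {{}}"
  have "\<Union>?R = \<Union>P \<inter> \<Union>Q" by auto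
  then have U: "\<Union>?R = I" using partition_Union[OF P] partition_Union[OF Q] by simp
  have disj: "G \<inter> H = {}" if "G \<in> ?R" "H \<in> ?R" "G \<noteq> H" for G H
  proof -
    from that obtain E F E' F' where *: "E \<in> P" "F \<in> Q" "G = E \<inter> F" "E' \<in> P" "F' \<in> Q" "H = E' \<inter> F'"
      by auto
    with \<open>G \<noteq> H\<close> have "E \<noteq> E' \<or> F \<noteq> F'" by blast
    then show ?thesis
      using partition_disjoint[OF P, of E E'] partition_disjoint[OF Q, of F F'] * by blast
  qed
  show "?R \<in> partitions I A"
    unfolding partitions_def
    using U disj partition_finite[OF P] partition_finite[OF Q] partition_in[OF P] partition_in[OF Q]
    by (auto simp del: Union_iff)
  show "\<And>G. G \<in> ?R \<Longrightarrow> \<exists>E\<in>P. G \<subseteq> E" by auto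
  show "\<And>G. G \<in> ?R \<Longrightarrow> \<exists>F\<in>Q. G \<subseteq> F" by auto
qed

text \<open>Linearity and monotonicity of \<open>chint\<close> come from this comparison with one
  tagged sum, which, unlike a supremum of lower sums, is linear in f. Any lower sum, split along P,
  exceeds the tagged sum by at most e; the lower sum of P itself falls short of it by at most
  e.\<close>

lemma chint_tag:
  assumes P: "P \<in> partitions I A" and osc: "osc_le P f e"
  shows "\<bar>chint I A \<mu> f - (\<Sum>E\<in>P. \<mu> E * f (tag E))\<bar> \<le> e"
proof -
  let ?S = "\<Sum>E\<in>P. \<mu> E * f (tag E)"
  have near: "\<bar>f i - f (tag E)\<bar> \<le> e" if "E \<in> P" "i \<in> E" for E i
    using osc that partition_tag[OF P] by (auto simp: osc_le_def)
  \<comment> \<open>Small oscillation on finitely many cells already bounds f from below, so the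
    infima in the lower sums are genuine.\<close>
  have bdd: "bdd_below (f ` F)" if "F \<subseteq> I" for F
  proof -
    have "bdd_below (\<Union>E\<in>P. f ` E)"
      unfolding bdd_below_UN[OF partition_finite[OF P]]
    proof
      fix E assume "E \<in> P"
      show "bdd_below (f ` E)"
        by (rule bdd_belowI2[where m = "f (tag E) - e"]) (use near[OF \<open>E \<in> P\<close>] in force)
    qed
    then show ?thesis
      by (rule bdd_below_mono) (use that partition_Union[OF P] in auto)
  qed
  have upper: "(\<Sum>F\<in>Q. \<mu> F * (INF i\<in>F. f i)) \<le> ?S + e" if Q: "Q \<in> partitions I A" for Q
  proof -
    have "(\<Sum>F\<in>Q. \<mu> F * (INF i\<in>F. f i)) = (\<Sum>F\<in>Q. \<Sum>E\<in>P. \<mu> (E \<inter> F) * (INF i\<in>F. f i))"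
      using mu_partition[OF P] partition_in[OF Q] by (simp add: sum_distrib_right)
    also have "\<dots> \<le> (\<Sum>F\<in>Q. \<Sum>E\<in>P. \<mu> (E \<inter> F) * (f (tag E) + e))"
    proof (intro sum_mono)
      fix F E assume FE: "F \<in> Q" "E \<in> P"
      show "\<mu> (E \<inter> F) * (INF i\<in>F. f i) \<le> \<mu> (E \<inter> F) * (f (tag E) + e)"
      proof (cases "E \<inter> F = {}")
        case True
        then show ?thesis by (simp add: mu_empty)
      next
        case False
        then obtain i where i: "i \<in> E" "i \<in> F" by blast
        have "F \<subseteq> I" using partition_in[OF Q] FE sets_into_space by blast
        then have "(INF i\<in>F. f i) \<le> f i" using i bdd by (intro cINF_lower) auto
        also have "\<dots> \<le> f (tag E) + e" using near[of E i] i FE by force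
        finally show ?thesis
          using FE partition_in[OF P] partition_in[OF Q] by (intro mult_left_mono mu_nonneg) auto
      qed
    qed
    also have "\<dots> = (\<Sum>E\<in>P. (\<Sum>F\<in>Q. \<mu> (F \<inter> E)) * (f (tag E) + e))"
      by (subst sum.swap) (simp add: sum_distrib_right Int_commute)
    also have "\<dots> = (\<Sum>E\<in>P. \<mu> E * (f (tag E) + e))"
      using mu_partition[OF Q] partition_in[OF P] by simp
    also have "\<dots> = ?S + e"
      using mu_partition_sum[OF P] by (simp add: distrib_left sum.distrib flip: sum_distrib_right)
    finally show ?thesis .
  qed
  have "?S - e = (\<Sum>E\<in>P. \<mu> E * (f (tag E) - e))"
    using mu_partition_sum[OF P]
    by (simp add: right_diff_distrib sum_subtractf flip: sum_distrib_right)
  also have "\<dots> \<le> (\<Sum>E\<in>P. \<mu> E * (INF i\<in>E. f i))"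
  proof (intro sum_mono mult_left_mono)
    fix E assume E: "E \<in> P"
    show "f (tag E) - e \<le> (INF i\<in>E. f i)"
      using near[OF E] partition_nonempty[OF P E] by (intro cINF_greatest) force+
    show "0 \<le> \<mu> E" using E P by (simp add: mu_nonneg partition_in)
  qed
  also have "\<dots> \<le> chint I A \<mu> f"
    unfolding chint_def using P upper by (intro cSUP_upper bdd_aboveI2[where M = "?S + e"])
  finally have "?S - e \<le> chint I A \<mu> f" .
  moreover have "chint I A \<mu> f \<le> ?S + e"
    unfolding chint_def using trivial_partition upper by (intro cSUP_least) auto
  ultimately show ?thesis by linarith
qed

lemma chint_cong:
  assumes "\<And>i. i \<in> I \<Longrightarrow> f i = g i"
  shows "chint I A \<mu> f = chint I A \<mu> g"
proof -
  have "(INF i\<in>E. f i) = (INF i\<in>E. g i)" if "P \<in> partitions I A" "E \<in> P" for P E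
    using that assms partition_Union by (intro INF_cong) auto
  then show ?thesis unfolding chint_def by (intro SUP_cong sum.cong) auto
qed

text \<open>The uniform closure of the simple functions. Measurability of level sets would not be stable
  under addition, since A need not be closed under countable unions when M is finite.\<close>

definition unif_simple :: "('i \<Rightarrow> real) \<Rightarrow> bool" where
  "unif_simple f \<longleftrightarrow> (\<forall>e>0. \<exists>P\<in>partitions I A. osc_le P f e)"

lemma unif_simple_common:
  assumes "unif_simple f" "unif_simple g" "e > 0"
  obtains P where "P \<in> partitions I A" "osc_le P f e" "osc_le P g e"
proof -
  obtain P Q where P: "P \<in> partitions I A" "osc_le P f e" and Q: "Q \<in> partitions I A" "osc_le Q g e"
    using assms by (meson unif_simple_def)
  obtain R where R: "R \<in> partitions I A" "\<And>G. G \<in> R \<Longrightarrow> \<exists>E\<in>P. G \<subseteq> E" "\<And>G. G \<in> R \<Longrightarrow> \<exists>F\<in>Q. G \<subseteq> F"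
    using partition_refine[OF P(1) Q(1)] by blast
  show thesis
  proof (rule that[OF R(1)])
    show "osc_le R f e" using P(2) R(2) unfolding osc_le_def by (meson subsetD)
    show "osc_le R g e" using Q(2) R(3) unfolding osc_le_def by (meson subsetD)
  qed
qed

lemma unif_simple_uniform_limit:
  assumes "\<And>e. e > 0 \<Longrightarrow> \<exists>g. unif_simple g \<and> (\<forall>i\<in>I. \<bar>f i - g i\<bar> \<le> e)"
  shows "unif_simple f"
  unfolding unif_simple_def
proof (intro allI impI)
  fix e :: real assume "e > 0"
  then obtain g where g: "unif_simple g" "\<forall>i\<in>I. \<bar>f i - g i\<bar> \<le> e / 3"
    using assms[of "e / 3"] by auto
  then obtain P where P: "P \<in> partitions I A" "osc_le P g (e / 3)"
    using \<open>e > 0\<close> unfolding unif_simple_def by (meson divide_pos_pos zero_less_numeral)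
  have "\<bar>f i - f j\<bar> \<le> e" if "E \<in> P" "i \<in> E" "j \<in> E" for E i j
  proof -
    have "i \<in> I" "j \<in> I" using that partition_Union[OF P(1)] by auto
    then have "\<bar>f i - g i\<bar> \<le> e / 3" "\<bar>f j - g j\<bar> \<le> e / 3" using g by auto
    moreover have "\<bar>g i - g j\<bar> \<le> e / 3" using that P by (auto simp: osc_le_def)
    ultimately show ?thesis by linarith
  qed
  then show "\<exists>P\<in>partitions I A. osc_le P f e"
    using P by (auto simp: osc_le_def)
qed

lemma osc_le_add: "osc_le P f e \<Longrightarrow> osc_le P g e' \<Longrightarrow> osc_le P (\<lambda>i. f i + g i) (e + e')"
  unfolding osc_le_def by (smt (verit, best))

lemma osc_le_cmult:
  assumes "osc_le P f e" shows "osc_le P (\<lambda>i. c * f i) (\<bar>c\<bar> * e)"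
  using assms unfolding osc_le_def
  by (auto simp: abs_mult mult_left_mono simp flip: right_diff_distrib)

lemma unif_simple_const: "unif_simple (\<lambda>i. c)"
  using trivial_partition by (auto simp: unif_simple_def osc_le_def)

lemma unif_simple_add:
  assumes f: "unif_simple f" and g: "unif_simple g"
  shows "unif_simple (\<lambda>i. f i + g i)"
  unfolding unif_simple_def
proof (intro allI impI)
  fix e :: real assume "e > 0"
  then obtain P where "P \<in> partitions I A" "osc_le P f (e/2)" "osc_le P g (e/2)"
    using unif_simple_common[OF f g, of "e/2"] by auto
  then show "\<exists>P\<in>partitions I A. osc_le P (\<lambda>i. f i + g i) e"
    using osc_le_add[of P f "e/2" g "e/2"] by auto
qed

lemma unif_simple_cmult:
  assumes f: "unif_simple f"
  shows "unif_simple (\<lambda>i. c * f i)"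
  unfolding unif_simple_def
proof (intro allI impI)
  fix e :: real assume "e > 0"
  then obtain P where P: "P \<in> partitions I A" "osc_le P f (e/(\<bar>c\<bar>+1))"
    using f unfolding unif_simple_def by (metis abs_ge_zero add_nonneg_pos divide_pos_pos zero_less_one)
  have "\<bar>c\<bar> * (e/(\<bar>c\<bar>+1)) \<le> e"
    using \<open>e > 0\<close> by (simp add: field_simps)
  then have "osc_le P (\<lambda>i. c * f i) e"
    using osc_le_cmult[OF P(2), of c] unfolding osc_le_def by (meson order_trans)
  then show "\<exists>P\<in>partitions I A. osc_le P (\<lambda>i. c * f i) e"
    using P by auto
qed

lemma unif_simple_sum:
  "finite V \<Longrightarrow> (\<And>k. k \<in> V \<Longrightarrow> unif_simple (f k)) \<Longrightarrow> unif_simple (\<lambda>i. \<Sum>k\<in>V. f k i)"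
  by (induction V rule: finite_induct) (auto intro: unif_simple_add unif_simple_const)

lemma chint_const: "chint I A \<mu> (\<lambda>i. c) = c"
  using chint_tag[OF trivial_partition, of "\<lambda>i. c" 0] by (simp add: osc_le_def mu_space)

text \<open>The fixed factor C spares the callers a rescaling of e. It can be 0, as when a function
  is multiplied by 0, hence the shifted denominator in the choice of e below, which brings the bound
  down to half the distance.\<close>

lemma eq_if_arbitrarily_close:
  fixes x y :: real
  assumes "\<And>e. e > 0 \<Longrightarrow> \<bar>x - y\<bar> \<le> C * e"
  shows "x = y"
proof (rule ccontr)
  assume "x \<noteq> y"
  then have "\<bar>x - y\<bar> \<le> C * (\<bar>x - y\<bar> / (2 * (\<bar>C\<bar> + 1)))" by (intro assms) simp
  also have "\<dots> \<le> \<bar>C\<bar> * (\<bar>x - y\<bar> / (2 * (\<bar>C\<bar> + 1)))"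
    by (intro mult_right_mono) auto
  also have "\<dots> \<le> \<bar>x - y\<bar> / 2"
    by (simp add: field_simps)
  finally show False using \<open>x \<noteq> y\<close> by simp
qed

lemma chint_add:
  assumes f: "unif_simple f" and g: "unif_simple g"
  shows "chint I A \<mu> (\<lambda>i. f i + g i) = chint I A \<mu> f + chint I A \<mu> g"
proof (rule eq_if_arbitrarily_close)
  fix e :: real assume "e > 0"
  then obtain P where P: "P \<in> partitions I A" "osc_le P f e" "osc_le P g e"
    using unif_simple_common[OF f g] by blast
  \<comment> \<open>One e for each of the two integrals, and e + e for the oscillation of the
    sum.\<close>
  show "\<bar>chint I A \<mu> (\<lambda>i. f i + g i) - (chint I A \<mu> f + chint I A \<mu> g)\<bar> \<le> 4 * e"
    using chint_tag[OF P(1,2)] chint_tag[OF P(1,3)] chint_tag[OF P(1) osc_le_add[OF P(2,3)]]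
    by (simp add: distrib_left sum.distrib)
qed

lemma chint_cmult:
  assumes f: "unif_simple f"
  shows "chint I A \<mu> (\<lambda>i. c * f i) = c * chint I A \<mu> f"
proof (rule eq_if_arbitrarily_close)
  fix e :: real assume "e > 0"
  then obtain P where P: "P \<in> partitions I A" "osc_le P f e"
    using f unfolding unif_simple_def by blast
  let ?S = "\<Sum>E\<in>P. \<mu> E * f (tag E)"
  have "\<bar>chint I A \<mu> (\<lambda>i. c * f i) - c * ?S\<bar> \<le> \<bar>c\<bar> * e"
    using chint_tag[OF P(1) osc_le_cmult[OF P(2), of c]] by (simp add: sum_distrib_left mult.left_commute)
  moreover have "\<bar>c * chint I A \<mu> f - c * ?S\<bar> \<le> \<bar>c\<bar> * e"
    using chint_tag[OF P] by (simp add: abs_mult mult_left_mono flip: right_diff_distrib)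
  ultimately show "\<bar>chint I A \<mu> (\<lambda>i. c * f i) - c * chint I A \<mu> f\<bar> \<le> (2 * \<bar>c\<bar>) * e"
    by linarith
qed

lemma chint_mono:
  assumes f: "unif_simple f" and g: "unif_simple g" and le: "\<And>i. i \<in> I \<Longrightarrow> f i \<le> g i"
  shows "chint I A \<mu> f \<le> chint I A \<mu> g"
proof (rule field_le_epsilon)
  fix e :: real assume "e > 0"
  then obtain P where P: "P \<in> partitions I A" "osc_le P f (e/2)" "osc_le P g (e/2)"
    using unif_simple_common[OF f g, of "e/2"] by auto
  have "(\<Sum>E\<in>P. \<mu> E * f (tag E)) \<le> (\<Sum>E\<in>P. \<mu> E * g (tag E))"
    using P(1) by (intro sum_mono mult_left_mono le mu_nonneg) (auto intro: partition_in partition_tag_space)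
  then show "chint I A \<mu> f \<le> chint I A \<mu> g + e"
    using chint_tag[OF P(1,2)] chint_tag[OF P(1,3)] by linarith
qed

lemma chint_sum:
  "finite V \<Longrightarrow> (\<And>k. k \<in> V \<Longrightarrow> unif_simple (f k)) \<Longrightarrow>
    chint I A \<mu> (\<lambda>i. \<Sum>k\<in>V. f k i) = (\<Sum>k\<in>V. chint I A \<mu> (f k))"
  by (induction V rule: finite_induct) (auto simp: chint_const chint_add unif_simple_sum)

text \<open>This is measurability for the full power set of the codomain, so it survives composition
  with an arbitrary function, in particular with a choice function.\<close>

definition discrete_meas :: "('i \<Rightarrow> 'b) \<Rightarrow> bool" where
  "discrete_meas h \<longleftrightarrow> (\<forall>T. {i\<in>I. h i \<in> T} \<in> A)"

lemma discrete_meas_comp: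
  assumes "discrete_meas h"
  shows "discrete_meas (\<lambda>i. g (h i))"
  unfolding discrete_meas_def
proof
  fix T
  show "{i\<in>I. g (h i) \<in> T} \<in> A"
    using assms[unfolded discrete_meas_def, rule_format, of "g -` T"] by simp
qed

text \<open>The cells are the nonempty level sets of floor(h / e). They lie in A because h is
  discrete, and boundedness leaves only finitely many of them.\<close>

lemma unif_simple_discrete:
  assumes h: "discrete_meas h" and bound: "\<And>i. i \<in> I \<Longrightarrow> \<bar>h i\<bar> \<le> C"
  shows "unif_simple h"
  unfolding unif_simple_def
proof (intro allI impI)
  fix e :: real assume "e > 0"
  define q where "q i = \<lfloor>h i / e\<rfloor>" for i
  let ?P = "(\<lambda>m. {i\<in>I. q i = m}) ` q ` I"
  have "q ` I \<subseteq> {\<lfloor>-C / e\<rfloor>..\<lfloor>C / e\<rfloor>}"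
  proof
    fix m assume "m \<in> q ` I"
    then obtain i where i: "i \<in> I" "m = \<lfloor>h i / e\<rfloor>" by (auto simp: q_def)
    have "- C \<le> h i" "h i \<le> C" using bound[OF i(1)] by auto
    then have "-C / e \<le> h i / e" "h i / e \<le> C / e"
      using \<open>e > 0\<close> by (intro divide_right_mono; simp)+
    then show "m \<in> {\<lfloor>-C / e\<rfloor>..\<lfloor>C / e\<rfloor>}"
      using i by (auto intro: floor_mono)
  qed
  then have fin: "finite (q ` I)" by (rule finite_subset) simp
  have "discrete_meas q" unfolding q_def by (rule discrete_meas_comp[OF h])
  then have "{i\<in>I. q i \<in> {m}} \<in> A" for m unfolding discrete_meas_def by blast
  then have "?P \<in> partitions I A"
    using fin by (auto simp: partitions_def)
  moreover have "osc_le ?P h e"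
  proof -
    have "\<bar>h i - h j\<bar> \<le> e" if "q i = q j" for i j
    proof -
      have "\<bar>h i / e - h j / e\<bar> \<le> 1"
        using that unfolding q_def by linarith
      then have "\<bar>h i - h j\<bar> / e \<le> 1"
        using \<open>e > 0\<close> by (simp add: diff_divide_distrib[symmetric] abs_divide)
      then show ?thesis using \<open>e > 0\<close> by (simp add: field_simps)
    qed
    then show ?thesis by (auto simp: osc_le_def)
  qed
  ultimately show "\<exists>P\<in>partitions I A. osc_le P h e" by blast
qed

end

section \<open>Meanability: dense index sets and measurable maps\<close>

locale mean = charge I A \<mu> for I :: "'i set" and A :: "'i set set" and \<mu> :: "'i set \<Rightarrow> real" +
  fixes L :: "('f, 'r) lang" and M :: "('a, 'f, 'r) struc"
  assumes struc: "is_Lstructure L M"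
    and meanable: "meanable A M"
begin

abbreviation car :: "'a set" where "car \<equiv> scarrier M"
abbreviation d :: "'a \<Rightarrow> 'a \<Rightarrow> real" where "d \<equiv> sdist M"
abbreviation meas :: "('i \<Rightarrow> 'a) \<Rightarrow> bool" where "meas \<equiv> meas_map I A M"
abbreviation cls :: "('i \<Rightarrow> 'a) \<Rightarrow> ('i \<Rightarrow> 'a) set" where "cls \<equiv> mcls I A \<mu> M"
abbreviation int :: "('i \<Rightarrow> real) \<Rightarrow> real" where "int \<equiv> chint I A \<mu>"

sublocale ms: Metric_space car d
  using struc by (simp add: is_Lstructure_def)

lemma car_nonempty: "car \<noteq> {}"
  and diam: "x \<in> car \<Longrightarrow> y \<in> car \<Longrightarrow> d x y \<le> 1"
  and sfun_closed: "set xs \<subseteq> car \<Longrightarrow> length xs = farity L F \<Longrightarrow> sfun M F xs \<in> car"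
  and sfun_lip: "set xs \<subseteq> car \<Longrightarrow> set ys \<subseteq> car \<Longrightarrow> length xs = farity L F \<Longrightarrow>
         length ys = farity L F \<Longrightarrow> d (sfun M F xs) (sfun M F ys) \<le> flip L F * tdist d xs ys"
  and srel_lip: "set xs \<subseteq> car \<Longrightarrow> set ys \<subseteq> car \<Longrightarrow> length xs = rarity L R \<Longrightarrow>
         length ys = rarity L R \<Longrightarrow> \<bar>srel M R xs - srel M R ys\<bar> \<le> rlip L R * tdist d xs ys"
  using struc by (simp_all add: is_Lstructure_def)

lemma open_sets_iff: "U \<in> open_sets M \<longleftrightarrow> openin ms.mtopology U"
  by (simp add: open_sets_def)

text \<open>Meanability speaks of intersections, so the union is reached through complements; the
  family of complements is an image of S and hence no larger. S has its own type because it is used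
  both with a dense subset of M and with the natural numbers.\<close>

lemma UN_closed_weight:
  assumes inf: "infinite car" and S: "card_le_weight M S" "S \<noteq> {}" and E: "\<And>y. y \<in> S \<Longrightarrow> E y \<in> A"
  shows "(\<Union>y\<in>S. E y) \<in> A"
proof -
  let ?F = "(\<lambda>y. I - E y) ` S"
  have F: "card_le_weight M ?F"
  proof (cases "countable S")
    case True
    then show ?thesis by (simp add: card_le_weight_def)
  next
    case False
    have "\<exists>g. inj_on g ?F \<and> g ` ?F \<subseteq> B" if "is_base M B" for B
    proof -
      have "|?F| \<le>o |S|" by (rule card_of_image)
      moreover have "|S| \<le>o |B|"
        using S(1) False that unfolding card_le_weight_def card_of_ordLeq[symmetric] by blast
      ultimately show ?thesis
        unfolding card_of_ordLeq by (rule ordLeq_transitive)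
    qed
    then show ?thesis by (simp add: card_le_weight_def)
  qed
  have "\<Inter>?F \<in> A"
  proof -
    have "?F \<subseteq> A" using E by auto
    moreover have "?F \<noteq> {}" using S(2) by simp
    ultimately show ?thesis
      using meanable inf F unfolding meanable_def by blast
  qed
  then have "I - \<Inter>?F \<in> A" by (rule compl_sets)
  moreover have "I - \<Inter>?F = (\<Union>y\<in>S. E y)"
  proof -
    have "E y \<subseteq> I" if "y \<in> S" for y using E[OF that] by (rule sets_into_space)
    then show ?thesis using S(2) by auto
  qed
  ultimately show ?thesis by simp
qed

text \<open>A dense set no larger than the weight (all of M when M is finite), so that A is closed under
  unions indexed by it; a base of least cardinality provides it.\<close>

definition index_set :: "'a set \<Rightarrow> bool" where
  "index_set D \<longleftrightarrow> D \<subseteq> car \<and> (\<forall>x\<in>car. \<forall>e>0. \<exists>y\<in>D. d x y < e) \<and>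
     (\<forall>E. (\<forall>y\<in>D. E y \<in> A) \<longrightarrow> (\<Union>y\<in>D. E y) \<in> A)"

lemma index_set_UN: "index_set D \<Longrightarrow> (\<And>y. y \<in> D \<Longrightarrow> E y \<in> A) \<Longrightarrow> (\<Union>y\<in>D. E y) \<in> A"
  by (simp add: index_set_def)

text \<open>Points of a dense set are picked from one base, whereas \<open>card_le_weight\<close>
  compares with all bases. Since any nonempty family of cardinals has a least member, one base lies
  below all others.\<close>

lemma minimal_base: "\<exists>B. is_base M B \<and> (\<forall>B'. is_base M B' \<longrightarrow> |B| \<le>o |B'| )"
proof -
  let ?R = "{|B| | B. is_base M B}"
  have "is_base M (open_sets M)"
    unfolding is_base_def
  proof (intro conjI ballI subset_refl)
    fix U assume "U \<in> open_sets M"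
    then show "\<exists>C\<subseteq>open_sets M. U = \<Union>C" by (intro exI[of _ "{U}"]) simp
  qed
  then have "?R \<noteq> {}" by blast
  then have "\<exists>r\<in>?R. \<forall>r'\<in>?R. r \<le>o r'"
    by (rule exists_minim_Card_order) (auto simp: card_of_Card_order)
  then show ?thesis by blast
qed

lemma index_set_exists: "\<exists>D. index_set D"
proof (cases "finite car")
  case True
  \<comment> \<open>A finite index set calls for finite unions only, which every algebra has; each
    point approximates itself.\<close>
  have "index_set car"
    unfolding index_set_def using True by (auto intro!: finite_UN bexI)
  then show ?thesis ..
next
  case False
  obtain B where B: "is_base M B" and min: "\<And>B'. is_base M B' \<Longrightarrow> |B| \<le>o |B'|"
    using minimal_base by blast
  \<comment> \<open>One point from each nonempty member of B. A ball around x is a union of base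
    members, so the member containing x has its chosen point inside the ball.\<close>
  define D where "D = (\<lambda>U. SOME x. x \<in> U) ` (B - {{}})"
  have "D \<subseteq> car"
  proof
    fix x assume "x \<in> D"
    then obtain U where U: "U \<in> B" "U \<noteq> {}" "x = (SOME x. x \<in> U)" by (auto simp: D_def)
    then have "x \<in> U" by (simp add: some_in_eq)
    moreover have "U \<subseteq> car"
      using U(1) B unfolding is_base_def by (meson open_sets_iff ms.openin_mtopology subsetD)
    ultimately show "x \<in> car" by blast
  qed
  moreover have dense: "\<exists>y\<in>D. d x y < e" if "x \<in> car" "e > 0" for x e
  proof -
    have "\<forall>U\<in>open_sets M. \<exists>C\<subseteq>B. U = \<Union>C" using B by (simp add: is_base_def)
    moreover have "ms.mball x e \<in> open_sets M" by (simp add: open_sets_iff)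
    ultimately have "\<exists>C\<subseteq>B. ms.mball x e = \<Union>C" by (rule bspec)
    then obtain C where C: "C \<subseteq> B" "ms.mball x e = \<Union>C" by auto
    have "x \<in> ms.mball x e" using that by simp
    then obtain U where U: "U \<in> C" "x \<in> U" using C by auto
    then have "(SOME y. y \<in> U) \<in> U" by (meson someI)
    then have "(SOME y. y \<in> U) \<in> ms.mball x e" using C U by blast
    moreover have "(SOME y. y \<in> U) \<in> D" using U C by (auto simp: D_def)
    ultimately show ?thesis by auto
  qed
  moreover have "(\<Union>y\<in>D. E y) \<in> A" if "\<forall>y\<in>D. E y \<in> A" for E
  proof (rule UN_closed_weight[OF False])
    have "|D| \<le>o |B'|" if "is_base M B'" for B'
    proof -
      have "|D| \<le>o |B - {{}}|" unfolding D_def by (rule card_of_image)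
      also have "|B - {{}}| \<le>o |B|" by (rule card_of_mono1) blast
      also have "|B| \<le>o |B'|" by (rule min[OF that])
      finally show ?thesis .
    qed
    then show "card_le_weight M D" unfolding card_le_weight_def card_of_ordLeq by blast
    show "D \<noteq> {}" using dense[of _ 1] car_nonempty by fastforce
  qed (use that in auto)
  ultimately have "index_set D" by (auto simp: index_set_def)
  then show ?thesis ..
qed

lemma meas_closed: "meas a \<Longrightarrow> i \<in> I \<Longrightarrow> a i \<in> car"
  by (auto simp: meas_map_def)

lemma meas_open: "meas a \<Longrightarrow> openin ms.mtopology U \<Longrightarrow> {i\<in>I. a i \<in> U} \<in> A"
  by (auto simp: meas_map_def borel_sets_def open_sets_def)

text \<open>Well-order D and take the first element of D that is e-close to the value.\<close>

lemma meas_discrete_approx: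
  assumes D: "index_set D" and a: "meas a" and "e > 0"
  obtains b where "discrete_meas b" "b \<in> I \<rightarrow> D" "\<And>i. i \<in> I \<Longrightarrow> d (a i) (b i) < e"
proof -
  have Dcar: "D \<subseteq> car" using D by (simp add: index_set_def)
  obtain r :: "'a rel" where r: "Well_order r" "Field r = UNIV" using well_ordering[where 'a = 'a] by auto
  have wf: "wf (r - Id)" using r by (simp add: well_order_on_def)
  have tot: "(x, y) \<in> r - Id \<or> (y, x) \<in> r - Id" if "x \<noteq> y" for x y
    using r that by (auto simp: well_order_on_def linear_order_on_def total_on_def)
  define first where "first i y \<longleftrightarrow> y \<in> D \<and> d (a i) y < e \<and>
    (\<forall>z\<in>D. (z, y) \<in> r - Id \<longrightarrow> \<not> d (a i) z < e)" for i y
  have ex: "\<exists>y. first i y" if "i \<in> I" for i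
  proof -
    have "\<exists>y\<in>D. d (a i) y < e"
      using D \<open>e > 0\<close> meas_closed[OF a that] by (simp add: index_set_def)
    then obtain y0 where y0: "y0 \<in> {y\<in>D. d (a i) y < e}" by auto
    obtain y where "y \<in> {y\<in>D. d (a i) y < e}" "\<And>z. (z, y) \<in> r - Id \<Longrightarrow> z \<notin> {y\<in>D. d (a i) y < e}"
      using wf y0 by (rule wfE_min) auto
    then have "first i y" unfolding first_def by auto
    then show ?thesis ..
  qed
  have uniq: "y = z" if "first i y" "first i z" for i y z
  proof (rule ccontr)
    assume "y \<noteq> z"
    then show False using tot[of y z] that unfolding first_def by auto
  qed
  define b where "b i = (SOME y. first i y)" for i
  have b: "first i (b i)" if "i \<in> I" for i
    unfolding b_def using ex[OF that] by (rule someI_ex)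
  have first_meas: "{i\<in>I. first i y} \<in> A" for y
  proof (cases "y \<in> D")
    case False
    then show ?thesis by (simp add: first_def)
  next
    case True
    \<comment> \<open>The points within e of some predecessor of y form a union of balls, which is
      open however many predecessors there are. So this set needs only Borel measurability of a; the
      closure of A under unions over D enters later, when the values in T are collected.\<close>
    let ?U = "\<Union>z\<in>{z\<in>D. (z, y) \<in> r - Id}. ms.mball z e"
    have "{i\<in>I. first i y} = {i\<in>I. a i \<in> ms.mball y e} - {i\<in>I. a i \<in> ?U}"
      using True Dcar meas_closed[OF a] by (auto simp: first_def ms.commute subset_iff)
    also have "\<dots> \<in> A"
      by (intro Diff meas_open[OF a]) auto
    finally show ?thesis .
  qed
  have "discrete_meas b"
    unfolding discrete_meas_def
  proof
    fix T
    have "{i\<in>I. b i \<in> T} = (\<Union>y\<in>D. if y \<in> T then {i\<in>I. first i y} else {})"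
    proof (intro equalityI subsetI)
      fix i assume "i \<in> {i\<in>I. b i \<in> T}"
      then have "i \<in> I" "b i \<in> T" "first i (b i)" "b i \<in> D" using b by (auto simp: first_def)
      then show "i \<in> (\<Union>y\<in>D. if y \<in> T then {i\<in>I. first i y} else {})"
        by (intro UN_I[of "b i"]) auto
    next
      fix i assume "i \<in> (\<Union>y\<in>D. if y \<in> T then {i\<in>I. first i y} else {})"
      then obtain y where "y \<in> T" "i \<in> I" "first i y" by (auto split: if_splits)
      then show "i \<in> {i\<in>I. b i \<in> T}" using b uniq by blast
    qed
    also have "\<dots> \<in> A"
      by (rule index_set_UN[OF D]) (simp add: first_meas)
    finally show "{i\<in>I. b i \<in> T} \<in> A" .
  qed
  then show thesis using that b by (auto simp: first_def)
qed

lemma meas_of_discrete: "discrete_meas b \<Longrightarrow> b \<in> I \<rightarrow> car \<Longrightarrow> meas b"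
  by (auto simp: discrete_meas_def meas_map_def)

text \<open>If M is finite, A may fail to be closed under countable unions, but a sufficiently close
  approximation then equals b. If M is infinite, A is closed under countable unions, and it suffices
  to treat preimages of open sets.\<close>

lemma meas_uniform_limit:
  assumes b: "b \<in> I \<rightarrow> car"
    and approx: "\<And>e. e > 0 \<Longrightarrow> \<exists>c. discrete_meas c \<and> c \<in> I \<rightarrow> car \<and> (\<forall>i\<in>I. d (b i) (c i) < e)"
  shows "meas b"
proof (cases "finite car")
  case True
  have "\<exists>e>0. \<forall>p\<in>car \<times> car. d (fst p) (snd p) < e \<longrightarrow> fst p = snd p"
  proof -
    \<comment> \<open>The element 1 keeps the set nonempty when M has a single point.\<close>
    let ?S = "insert 1 ((\<lambda>p. d (fst p) (snd p)) ` {p\<in>car \<times> car. fst p \<noteq> snd p})"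
    have fin: "finite ?S" using True by simp
    have "Min ?S > 0" using fin by (subst Min_gr_iff) (auto simp: less_le)
    moreover have "\<not> d (fst p) (snd p) < Min ?S" if "p \<in> car \<times> car" "fst p \<noteq> snd p" for p
      unfolding not_less using that by (intro Min_le fin) auto
    ultimately show ?thesis by blast
  qed
  then obtain e where "e > 0" and e': "\<forall>p\<in>car \<times> car. d (fst p) (snd p) < e \<longrightarrow> fst p = snd p"
    by auto
  have e: "x = y" if "x \<in> car" "y \<in> car" "d x y < e" for x y
    using bspec[OF e', of "(x, y)"] that by simp
  obtain c where c: "discrete_meas c" "c \<in> I \<rightarrow> car" "\<forall>i\<in>I. d (b i) (c i) < e"
    using approx[OF \<open>e > 0\<close>] by auto
  have eq: "b i = c i" if "i \<in> I" for i using c b that by (intro e) auto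
  have "{i\<in>I. b i \<in> B} = {i\<in>I. c i \<in> B}" for B using eq by auto
  then show ?thesis using b meas_of_discrete[OF c(1,2)] by (simp add: meas_map_def)
next
  case False
  have UN: "(\<Union>n. E n) \<in> A" if "\<And>n. E n \<in> A" for E :: "nat \<Rightarrow> 'i set"
    using UN_closed_weight[OF False, of UNIV E] that by (auto simp: card_le_weight_def)
  have "\<exists>c. discrete_meas c \<and> c \<in> I \<rightarrow> car \<and> (\<forall>i\<in>I. d (b i) (c i) < 1 / real (Suc n))" for n
    by (rule approx) simp
  then obtain c where c: "\<And>n. discrete_meas (c n)" "\<And>n. c n \<in> I \<rightarrow> car"
      "\<And>n i. i \<in> I \<Longrightarrow> d (b i) (c n i) < 1 / real (Suc n)"
    by metis
  have op: "{i\<in>I. b i \<in> U} \<in> A" if U: "openin ms.mtopology U" for U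
  proof -
    \<comment> \<open>The ball has the same radius as the error of \<open>c n\<close>, so it
      contains \<open>b i\<close> whenever it is centred at \<open>c n i\<close>. The preimage of
      \<open>?U n\<close> under \<open>c n\<close> lies in A simply because \<open>c n\<close> is
      discrete.\<close>
    let ?U = "\<lambda>n. {x\<in>car. ms.mball x (1 / real (Suc n)) \<subseteq> U}"
    have "{i\<in>I. b i \<in> U} = (\<Union>n. {i\<in>I. c n i \<in> ?U n})"
    proof (intro equalityI subsetI)
      fix i assume i: "i \<in> {i\<in>I. b i \<in> U}"
      then obtain s where s: "s > 0" "ms.mball (b i) s \<subseteq> U"
        using U by (auto simp: ms.openin_mtopology)
      \<comment> \<open>Half of s pays for the approximation error and half for the radius of the
        ball around \<open>c n i\<close>.\<close>
      obtain n where n: "1 / real (Suc n) < s / 2"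
        using nat_approx_posE[of "s / 2"] s(1) by auto
      have bi: "b i \<in> car" and ci: "c n i \<in> car" using b c(2) i by auto
      have "ms.mball (c n i) (1 / real (Suc n)) \<subseteq> ms.mball (b i) s"
      proof
        fix y assume y: "y \<in> ms.mball (c n i) (1 / real (Suc n))"
        then have "y \<in> car" "d (c n i) y < 1 / real (Suc n)" by auto
        moreover have "d (b i) y \<le> d (b i) (c n i) + d (c n i) y"
          using bi ci \<open>y \<in> car\<close> by (rule ms.triangle)
        moreover have "d (b i) (c n i) < 1 / real (Suc n)" using c(3) i by auto
        ultimately have "d (b i) y < s" using n by linarith
        then show "y \<in> ms.mball (b i) s" using bi \<open>y \<in> car\<close> by simp
      qed
      then show "i \<in> (\<Union>n. {i\<in>I. c n i \<in> ?U n})" using i s ci by blast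
    next
      fix i assume "i \<in> (\<Union>n. {i\<in>I. c n i \<in> ?U n})"
      then obtain n where n: "i \<in> I" "c n i \<in> car" "ms.mball (c n i) (1 / real (Suc n)) \<subseteq> U" by blast
      have "b i \<in> ms.mball (c n i) (1 / real (Suc n))"
        using n b c(3)[OF n(1), of n] by (auto simp: ms.commute)
      then show "i \<in> {i\<in>I. b i \<in> U}" using n by blast
    qed
    also have "\<dots> \<in> A" using c(1) unfolding discrete_meas_def by (intro UN) blast
    finally show ?thesis .
  qed
  have "{i\<in>I. b i \<in> B} \<in> A" if "B \<in> sigma_sets car (open_sets M)" for B
    using that
  proof (induction rule: sigma_sets.induct)
    case (Basic U)
    then show ?case using op by (simp add: open_sets_iff)
  next
    case Empty
    then show ?case by simp
  next
    case (Compl B)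
    have "{i\<in>I. b i \<in> car - B} = I - {i\<in>I. b i \<in> B}" using b by auto
    then show ?case using Compl by auto
  next
    case (Union B)
    have "{i\<in>I. b i \<in> (\<Union>n. B n)} = (\<Union>n. {i\<in>I. b i \<in> B n})" by auto
    then show ?case using UN[OF Union.IH] by simp
  qed
  then show ?thesis using b by (simp add: meas_map_def borel_sets_def)
qed

text \<open>A set T of tuples is sliced by the value of the new coordinate; the slices are indexed
  by D, which is why all coordinates must be D-valued. \<open>restrict\<close> fixes the values
  outside V, so that the empty tuple is constant.\<close>

lemma discrete_tuple:
  fixes a :: "'k \<Rightarrow> 'i \<Rightarrow> 'a"
  assumes D: "index_set D" and "finite V"
    and "\<And>k. k \<in> V \<Longrightarrow> discrete_meas (a k)" "\<And>k. k \<in> V \<Longrightarrow> a k \<in> I \<rightarrow> D"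
  shows "discrete_meas (\<lambda>i. restrict (\<lambda>k. a k i) V)"
  using assms(2-)
proof (induction V rule: finite_induct)
  case empty
  have "{i\<in>I. t \<in> T} \<in> A" for t :: "'k \<Rightarrow> 'a" and T by (cases "t \<in> T") auto
  then show ?case by (simp add: discrete_meas_def)
next
  case (insert x V)
  let ?h = "\<lambda>i. restrict (\<lambda>k. a k i) V"
  have eq: "restrict (\<lambda>k. a k i) (insert x V) = (?h i)(x := a x i)" for i
    by (auto simp: restrict_def)
  have IH: "discrete_meas ?h" using insert.prems by (intro insert.IH) auto
  show ?case
    unfolding discrete_meas_def
  proof
    fix T
    have "{i\<in>I. restrict (\<lambda>k. a k i) (insert x V) \<in> T} =
        (\<Union>y\<in>D. {i\<in>I. ?h i \<in> {t. t(x := y) \<in> T}} \<inter> {i\<in>I. a x i \<in> {y}})"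
      unfolding eq using insert.prems(2)[of x] by auto
    also have "\<dots> \<in> A"
      using IH insert.prems(1)[of x] unfolding discrete_meas_def
      by (intro index_set_UN[OF D] Int) blast+
    finally show "{i\<in>I. restrict (\<lambda>k. a k i) (insert x V) \<in> T} \<in> A" .
  qed
qed

section \<open>Lipschitz functions of finitely many variables\<close>

definition vdist :: "nat set \<Rightarrow> (nat \<Rightarrow> 'a) \<Rightarrow> (nat \<Rightarrow> 'a) \<Rightarrow> real" where
  "vdist V v w = (\<Sum>k\<in>V. d (v k) (w k))"

text \<open>Only coordinates in V enter the bound, so for valuations with these coordinates in the
  carrier the value depends on them alone. This takes the place of a coincidence lemma for free
  variables.\<close>

definition lip_val :: "nat set \<Rightarrow> ((nat \<Rightarrow> 'a) \<Rightarrow> real) \<Rightarrow> bool" where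
  "lip_val V \<Phi> \<longleftrightarrow> (\<exists>K\<ge>0. \<forall>v\<in>V \<rightarrow> car. \<forall>w\<in>V \<rightarrow> car. \<bar>\<Phi> v - \<Phi> w\<bar> \<le> K * vdist V v w)"

definition lip_map :: "nat set \<Rightarrow> ((nat \<Rightarrow> 'a) \<Rightarrow> 'a) \<Rightarrow> bool" where
  "lip_map V \<tau> \<longleftrightarrow> (\<forall>v\<in>V \<rightarrow> car. \<tau> v \<in> car) \<and>
     (\<exists>K\<ge>0. \<forall>v\<in>V \<rightarrow> car. \<forall>w\<in>V \<rightarrow> car. d (\<tau> v) (\<tau> w) \<le> K * vdist V v w)"

lemma vdist_nonneg: "0 \<le> vdist V v w"
  unfolding vdist_def by (intro sum_nonneg) simp

lemma vdist_le_card: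
  assumes "v \<in> V \<rightarrow> car" "w \<in> V \<rightarrow> car"
  shows "vdist V v w \<le> real (card V)"
proof -
  have "vdist V v w \<le> (\<Sum>k\<in>V. 1)"
    unfolding vdist_def using assms by (intro sum_mono diam) auto
  then show ?thesis by simp
qed

text \<open>The common value at x contributes 0. The inequality can be strict, since x may already
  lie in V with different old values.\<close>

lemma vdist_update:
  assumes "finite V" "c \<in> car"
  shows "vdist (insert x V) (v(x := c)) (w(x := c)) \<le> vdist V v w"
proof -
  have "vdist (insert x V) (v(x := c)) (w(x := c)) = (\<Sum>k\<in>V - {x}. d (v k) (w k))"
    unfolding vdist_def using assms by (subst sum.insert_remove) (auto intro: sum.cong)
  also have "\<dots> \<le> vdist V v w"
    unfolding vdist_def using assms by (intro sum_mono2) auto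
  finally show ?thesis .
qed

text \<open>With diameter at most 1, \<open>vdist\<close> is at most the number of variables, so a
  Lipschitz function stays near its value at a constant valuation. Relation symbols and formulas get
  their bounds this way.\<close>

lemma lip_val_bounded:
  assumes "lip_val V \<Phi>"
  obtains C where "\<And>v. v \<in> V \<rightarrow> car \<Longrightarrow> \<bar>\<Phi> v\<bar> \<le> C"
proof -
  obtain K where K: "K \<ge> 0" "\<And>v w. v \<in> V \<rightarrow> car \<Longrightarrow> w \<in> V \<rightarrow> car \<Longrightarrow> \<bar>\<Phi> v - \<Phi> w\<bar> \<le> K * vdist V v w"
    using assms unfolding lip_val_def by blast
  obtain m where m: "m \<in> car" using car_nonempty by blast
  have "\<bar>\<Phi> v\<bar> \<le> \<bar>\<Phi> (\<lambda>_. m)\<bar> + K * real (card V)" if v: "v \<in> V \<rightarrow> car" for v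
  proof -
    have "\<bar>\<Phi> v - \<Phi> (\<lambda>_. m)\<bar> \<le> K * vdist V v (\<lambda>_. m)" using v m by (intro K) auto
    also have "\<dots> \<le> K * real (card V)" using v m K(1) by (intro mult_left_mono vdist_le_card) auto
    finally show ?thesis by linarith
  qed
  then show thesis by (rule that)
qed

lemma tuple_approx:
  assumes V: "finite V" and a: "\<And>k. k \<in> V \<Longrightarrow> meas (a k)" and "e > 0"
  shows "\<exists>h. discrete_meas h \<and> (\<forall>i\<in>I. h i \<in> V \<rightarrow> car) \<and> (\<forall>i\<in>I. vdist V (\<lambda>k. a k i) (h i) \<le> e)"
proof -
  obtain D where D: "index_set D" using index_set_exists by blast
  \<comment> \<open>The error e is shared among the coordinates; the + 1 covers an empty V.\<close>
  define \<eta> where "\<eta> = e / (real (card V) + 1)"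
  have "\<eta> > 0" using \<open>e > 0\<close> by (simp add: \<eta>_def)
  have "\<exists>b. discrete_meas b \<and> b \<in> I \<rightarrow> D \<and> (\<forall>i\<in>I. d (a k i) (b i) < \<eta>)" if "k \<in> V" for k
    using meas_discrete_approx[OF D a[OF that] \<open>\<eta> > 0\<close>] by metis
  then obtain b where b: "\<And>k. k \<in> V \<Longrightarrow> discrete_meas (b k)" "\<And>k. k \<in> V \<Longrightarrow> b k \<in> I \<rightarrow> D"
      "\<And>k i. k \<in> V \<Longrightarrow> i \<in> I \<Longrightarrow> d (a k i) (b k i) < \<eta>"
    by metis
  show ?thesis
  proof (intro exI[of _ "\<lambda>i. restrict (\<lambda>k. b k i) V"] conjI ballI)
    show "discrete_meas (\<lambda>i. restrict (\<lambda>k. b k i) V)" by (rule discrete_tuple[OF D V b(1,2)])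
    fix i assume i: "i \<in> I"
    show "restrict (\<lambda>k. b k i) V \<in> V \<rightarrow> car"
      using b(2) i D by (auto simp: index_set_def)
    have "vdist V (\<lambda>k. a k i) (restrict (\<lambda>k. b k i) V) \<le> (\<Sum>k\<in>V. \<eta>)"
      unfolding vdist_def using b(3) i by (intro sum_mono) (auto intro: less_imp_le)
    also have "\<dots> \<le> e" using \<open>e > 0\<close> by (simp add: \<eta>_def field_simps)
    finally show "vdist V (\<lambda>k. a k i) (restrict (\<lambda>k. b k i) V) \<le> e" .
  qed
qed

text \<open>The shift by 1 handles K = 0 and yields the strict inequality that
  \<open>meas_uniform_limit\<close> asks for.\<close>

lemma scaled_pos:
  fixes e K :: real assumes "e > 0" "K \<ge> 0"
  shows "e / (K + 1) > 0" "K * (e / (K + 1)) < e"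
  using assms by (simp_all add: field_simps)

lemma lip_val_unif_simple:
  assumes V: "finite V" and a: "\<And>k. k \<in> V \<Longrightarrow> meas (a k)" and \<Phi>: "lip_val V \<Phi>"
  shows "unif_simple (\<lambda>i. \<Phi> (\<lambda>k. a k i))"
proof (rule unif_simple_uniform_limit)
  fix e :: real assume "e > 0"
  obtain K where K: "K \<ge> 0" "\<And>v w. v \<in> V \<rightarrow> car \<Longrightarrow> w \<in> V \<rightarrow> car \<Longrightarrow> \<bar>\<Phi> v - \<Phi> w\<bar> \<le> K * vdist V v w"
    using \<Phi> unfolding lip_val_def by blast
  note sc = scaled_pos[OF \<open>e > 0\<close> K(1)]
  obtain h where h: "discrete_meas h" "\<And>i. i \<in> I \<Longrightarrow> h i \<in> V \<rightarrow> car"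
      "\<And>i. i \<in> I \<Longrightarrow> vdist V (\<lambda>k. a k i) (h i) \<le> e / (K + 1)"
    using tuple_approx[of V a, OF V a sc(1)] by auto
  obtain C where C: "\<And>v. v \<in> V \<rightarrow> car \<Longrightarrow> \<bar>\<Phi> v\<bar> \<le> C" using lip_val_bounded[OF \<Phi>] by blast
  have "unif_simple (\<lambda>i. \<Phi> (h i))"
    by (rule unif_simple_discrete[OF discrete_meas_comp[OF h(1)]]) (rule C[OF h(2)])
  moreover have "\<bar>\<Phi> (\<lambda>k. a k i) - \<Phi> (h i)\<bar> \<le> e" if i: "i \<in> I" for i
  proof -
    have "\<bar>\<Phi> (\<lambda>k. a k i) - \<Phi> (h i)\<bar> \<le> K * vdist V (\<lambda>k. a k i) (h i)"
      using a i h(2) by (intro K) (auto intro: meas_closed)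
    also have "\<dots> \<le> K * (e / (K + 1))" using K(1) h(3)[OF i] by (intro mult_left_mono)
    finally show ?thesis using sc(2) by linarith
  qed
  ultimately show "\<exists>g. unif_simple g \<and> (\<forall>i\<in>I. \<bar>\<Phi> (\<lambda>k. a k i) - g i\<bar> \<le> e)" by blast
qed

text \<open>The approximants \<open>\<tau> (h i)\<close> are discrete because h is, although their
  values may leave the dense set; this is why \<open>meas_uniform_limit\<close> is phrased with
  approximants that are merely carrier-valued.\<close>

lemma lip_map_meas:
  assumes V: "finite V" and a: "\<And>k. k \<in> V \<Longrightarrow> meas (a k)" and \<tau>: "lip_map V \<tau>"
  shows "meas (\<lambda>i. \<tau> (\<lambda>k. a k i))"
proof (rule meas_uniform_limit)
  have closed: "\<tau> v \<in> car" if "v \<in> V \<rightarrow> car" for v using \<tau> that by (simp add: lip_map_def)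
  have a_car: "(\<lambda>k. a k i) \<in> V \<rightarrow> car" if "i \<in> I" for i using a that by (auto intro: meas_closed)
  show "(\<lambda>i. \<tau> (\<lambda>k. a k i)) \<in> I \<rightarrow> car" using a_car closed by auto
  fix e :: real assume "e > 0"
  obtain K where K: "K \<ge> 0" "\<And>v w. v \<in> V \<rightarrow> car \<Longrightarrow> w \<in> V \<rightarrow> car \<Longrightarrow> d (\<tau> v) (\<tau> w) \<le> K * vdist V v w"
    using \<tau> unfolding lip_map_def by blast
  note sc = scaled_pos[OF \<open>e > 0\<close> K(1)]
  obtain h where h: "discrete_meas h" "\<And>i. i \<in> I \<Longrightarrow> h i \<in> V \<rightarrow> car"
      "\<And>i. i \<in> I \<Longrightarrow> vdist V (\<lambda>k. a k i) (h i) \<le> e / (K + 1)"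
    using tuple_approx[of V a, OF V a sc(1)] by auto
  have "d (\<tau> (\<lambda>k. a k i)) (\<tau> (h i)) < e" if i: "i \<in> I" for i
  proof -
    have "d (\<tau> (\<lambda>k. a k i)) (\<tau> (h i)) \<le> K * vdist V (\<lambda>k. a k i) (h i)"
      using a_car[OF i] h(2)[OF i] by (rule K)
    also have "\<dots> \<le> K * (e / (K + 1))" using K(1) h(3)[OF i] by (intro mult_left_mono)
    finally show ?thesis using sc(2) by linarith
  qed
  moreover have "(\<lambda>i. \<tau> (h i)) \<in> I \<rightarrow> car" using closed h(2) by auto
  ultimately show "\<exists>c. discrete_meas c \<and> c \<in> I \<rightarrow> car \<and> (\<forall>i\<in>I. d (\<tau> (\<lambda>k. a k i)) (c i) < e)"
    using discrete_meas_comp[OF h(1), of \<tau>] by blast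
qed

lemma lip_map_proj: "finite V \<Longrightarrow> k \<in> V \<Longrightarrow> lip_map V (\<lambda>v. v k)"
  unfolding lip_map_def vdist_def
  by (auto intro!: exI[of _ 1] member_le_sum)

lemma lip_map_comp_bound:
  assumes W: "finite W" and \<tau>: "\<And>j. j \<in> W \<Longrightarrow> lip_map V (\<tau> j)"
  shows "\<exists>K\<ge>0. \<forall>v\<in>V \<rightarrow> car. \<forall>w\<in>V \<rightarrow> car.
    vdist W (\<lambda>j. \<tau> j v) (\<lambda>j. \<tau> j w) \<le> K * vdist V v w"
proof -
  have "\<exists>K\<ge>0. \<forall>v\<in>V \<rightarrow> car. \<forall>w\<in>V \<rightarrow> car. d (\<tau> j v) (\<tau> j w) \<le> K * vdist V v w" if "j \<in> W" for j
    using \<tau>[OF that] by (simp add: lip_map_def)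
  then obtain K where K: "\<And>j. j \<in> W \<Longrightarrow> K j \<ge> 0"
     "\<And>j v w. j \<in> W \<Longrightarrow> v \<in> V \<rightarrow> car \<Longrightarrow> w \<in> V \<rightarrow> car \<Longrightarrow> d (\<tau> j v) (\<tau> j w) \<le> K j * vdist V v w"
    by metis
  show ?thesis
  proof (intro exI[of _ "sum K W"] conjI ballI)
    show "0 \<le> sum K W" using K(1) by (rule sum_nonneg)
    show "vdist W (\<lambda>j. \<tau> j v) (\<lambda>j. \<tau> j w) \<le> sum K W * vdist V v w"
      if "v \<in> V \<rightarrow> car" "w \<in> V \<rightarrow> car" for v w
      unfolding vdist_def[of W] sum_distrib_right using that by (intro sum_mono K(2))
  qed
qed

lemma lip_map_comp:
  assumes W: "finite W" and \<sigma>: "lip_map W \<sigma>" and \<tau>: "\<And>j. j \<in> W \<Longrightarrow> lip_map V (\<tau> j)"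
  shows "lip_map V (\<lambda>v. \<sigma> (\<lambda>j. \<tau> j v))"
proof -
  obtain K where K: "K \<ge> 0" "\<And>v w. v \<in> V \<rightarrow> car \<Longrightarrow> w \<in> V \<rightarrow> car \<Longrightarrow>
    vdist W (\<lambda>j. \<tau> j v) (\<lambda>j. \<tau> j w) \<le> K * vdist V v w"
    using lip_map_comp_bound[of W V \<tau>, OF W \<tau>] by auto
  obtain K' where K': "K' \<ge> 0" "\<And>v w. v \<in> W \<rightarrow> car \<Longrightarrow> w \<in> W \<rightarrow> car \<Longrightarrow> d (\<sigma> v) (\<sigma> w) \<le> K' * vdist W v w"
    using \<sigma> unfolding lip_map_def by blast
  have W_car: "(\<lambda>j. \<tau> j v) \<in> W \<rightarrow> car" if "v \<in> V \<rightarrow> car" for v using \<tau> that by (auto simp: lip_map_def)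
  show ?thesis
    unfolding lip_map_def
  proof (intro conjI ballI exI[of _ "K' * K"])
    fix v w assume vw: "v \<in> V \<rightarrow> car" "w \<in> V \<rightarrow> car"
    have "d (\<sigma> (\<lambda>j. \<tau> j v)) (\<sigma> (\<lambda>j. \<tau> j w)) \<le> K' * vdist W (\<lambda>j. \<tau> j v) (\<lambda>j. \<tau> j w)"
      using vw by (intro K' W_car)
    also have "\<dots> \<le> K' * (K * vdist V v w)" using K'(1) K(2)[OF vw] by (intro mult_left_mono)
    finally show "d (\<sigma> (\<lambda>j. \<tau> j v)) (\<sigma> (\<lambda>j. \<tau> j w)) \<le> K' * K * vdist V v w" by (simp add: mult.assoc)
  qed (use \<sigma> W_car K K' in \<open>auto simp: lip_map_def\<close>)
qed

lemma lip_val_comp: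
  assumes W: "finite W" and \<Psi>: "lip_val W \<Psi>" and \<tau>: "\<And>j. j \<in> W \<Longrightarrow> lip_map V (\<tau> j)"
  shows "lip_val V (\<lambda>v. \<Psi> (\<lambda>j. \<tau> j v))"
proof -
  obtain K where K: "K \<ge> 0" "\<And>v w. v \<in> V \<rightarrow> car \<Longrightarrow> w \<in> V \<rightarrow> car \<Longrightarrow>
    vdist W (\<lambda>j. \<tau> j v) (\<lambda>j. \<tau> j w) \<le> K * vdist V v w"
    using lip_map_comp_bound[of W V \<tau>, OF W \<tau>] by auto
  obtain K' where K': "K' \<ge> 0" "\<And>v w. v \<in> W \<rightarrow> car \<Longrightarrow> w \<in> W \<rightarrow> car \<Longrightarrow> \<bar>\<Psi> v - \<Psi> w\<bar> \<le> K' * vdist W v w"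
    using \<Psi> unfolding lip_val_def by blast
  have W_car: "(\<lambda>j. \<tau> j v) \<in> W \<rightarrow> car" if "v \<in> V \<rightarrow> car" for v using \<tau> that by (auto simp: lip_map_def)
  show ?thesis
    unfolding lip_val_def
  proof (intro conjI ballI exI[of _ "K' * K"])
    fix v w assume vw: "v \<in> V \<rightarrow> car" "w \<in> V \<rightarrow> car"
    have "\<bar>\<Psi> (\<lambda>j. \<tau> j v) - \<Psi> (\<lambda>j. \<tau> j w)\<bar> \<le> K' * vdist W (\<lambda>j. \<tau> j v) (\<lambda>j. \<tau> j w)"
      using vw by (intro K' W_car)
    also have "\<dots> \<le> K' * (K * vdist V v w)" using K'(1) K(2)[OF vw] by (intro mult_left_mono)
    finally show "\<bar>\<Psi> (\<lambda>j. \<tau> j v) - \<Psi> (\<lambda>j. \<tau> j w)\<bar> \<le> K' * K * vdist V v w" by (simp add: mult.assoc)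
  qed (use K K' in auto)
qed

text \<open>Casting the metric as a function of the variables 0 and 1 makes the general lemmas on
  Lipschitz functions apply to distances between measurable maps and between terms.\<close>

lemma lip_val_dist: "lip_val {0, 1} (\<lambda>v. d (v 0) (v 1))"
  unfolding lip_val_def vdist_def
proof (intro exI[of _ 1] conjI ballI)
  fix v w :: "nat \<Rightarrow> 'a" assume "v \<in> {0, 1} \<rightarrow> car" "w \<in> {0, 1} \<rightarrow> car"
  then have *: "v 0 \<in> car" "v 1 \<in> car" "w 0 \<in> car" "w 1 \<in> car" by auto
  have "d (v 0) (v 1) \<le> d (v 0) (w 0) + d (w 0) (w 1) + d (v 1) (w 1)"
    using ms.triangle[OF *(1,3,2)] ms.triangle[OF *(3,4,2)] ms.commute[of "v 1" "w 1"] by linarith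
  moreover have "d (w 0) (w 1) \<le> d (v 0) (w 0) + d (v 0) (v 1) + d (v 1) (w 1)"
    using ms.triangle[OF *(3,1,4)] ms.triangle[OF *(1,2,4)] ms.commute[of "v 0" "w 0"] by linarith
  ultimately show "\<bar>d (v 0) (v 1) - d (w 0) (w 1)\<bar> \<le> 1 * (\<Sum>k\<in>{0, 1}. d (v k) (w k))"
    by (simp add: abs_le_iff)
qed simp

lemma unif_simple_dist:
  assumes "meas a" "meas b" shows "unif_simple (\<lambda>i. d (a i) (b i))"
  using lip_val_unif_simple[OF _ _ lip_val_dist, of "\<lambda>k. if k = 0 then a else b"] assms by simp

section \<open>Independence of representatives\<close>

lemma chint_vdist_null:
  assumes V: "finite V" and a: "\<And>k. k \<in> V \<Longrightarrow> meas (a k)" and b: "\<And>k. k \<in> V \<Longrightarrow> meas (b k)"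
    and null: "\<And>k. k \<in> V \<Longrightarrow> int (\<lambda>i. d (a k i) (b k i)) = 0"
  shows "unif_simple (\<lambda>i. K * vdist V (\<lambda>k. a k i) (\<lambda>k. b k i))"
    "int (\<lambda>i. K * vdist V (\<lambda>k. a k i) (\<lambda>k. b k i)) = 0"
proof -
  have u: "unif_simple (\<lambda>i. d (a k i) (b k i))" if "k \<in> V" for k
    using that by (intro unif_simple_dist a b)
  have s: "unif_simple (\<lambda>i. vdist V (\<lambda>k. a k i) (\<lambda>k. b k i))"
    unfolding vdist_def by (rule unif_simple_sum[OF V u])
  show "unif_simple (\<lambda>i. K * vdist V (\<lambda>k. a k i) (\<lambda>k. b k i))"
    by (rule unif_simple_cmult[OF s])
  have "int (\<lambda>i. vdist V (\<lambda>k. a k i) (\<lambda>k. b k i)) = 0"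
    unfolding vdist_def by (subst chint_sum[OF V u]) (simp_all add: null)
  then show "int (\<lambda>i. K * vdist V (\<lambda>k. a k i) (\<lambda>k. b k i)) = 0"
    by (simp add: chint_cmult[OF s])
qed

text \<open>The two integrands differ by at most a multiple of the coordinate distances, and these
  integrate to 0. Hence integrals of Lipschitz functions depend only on the classes of the
  arguments.\<close>

lemma lip_val_null_eq:
  assumes V: "finite V" and a: "\<And>k. k \<in> V \<Longrightarrow> meas (a k)" and b: "\<And>k. k \<in> V \<Longrightarrow> meas (b k)"
    and null: "\<And>k. k \<in> V \<Longrightarrow> int (\<lambda>i. d (a k i) (b k i)) = 0"
    and \<Phi>: "lip_val V \<Phi>"
  shows "int (\<lambda>i. \<Phi> (\<lambda>k. a k i)) = int (\<lambda>i. \<Phi> (\<lambda>k. b k i))"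
proof -
  obtain K where K: "K \<ge> 0" "\<And>v w. v \<in> V \<rightarrow> car \<Longrightarrow> w \<in> V \<rightarrow> car \<Longrightarrow> \<bar>\<Phi> v - \<Phi> w\<bar> \<le> K * vdist V v w"
    using \<Phi> unfolding lip_val_def by blast
  let ?r = "\<lambda>i. K * vdist V (\<lambda>k. a k i) (\<lambda>k. b k i)"
  have r: "unif_simple ?r" "int ?r = 0"
    using chint_vdist_null[of V a b K, OF V a b null] by auto
  have ua: "unif_simple (\<lambda>i. \<Phi> (\<lambda>k. a k i))" and ub: "unif_simple (\<lambda>i. \<Phi> (\<lambda>k. b k i))"
    using V a b \<Phi> by (auto intro: lip_val_unif_simple)
  have close: "\<bar>\<Phi> (\<lambda>k. a k i) - \<Phi> (\<lambda>k. b k i)\<bar> \<le> ?r i" if "i \<in> I" for i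
    using a b that by (intro K) (auto intro: meas_closed)
  have "int (\<lambda>i. \<Phi> (\<lambda>k. a k i)) \<le> int (\<lambda>i. \<Phi> (\<lambda>k. b k i) + ?r i)"
    by (intro chint_mono unif_simple_add ua ub r(1)) (drule close, linarith)
  moreover have "int (\<lambda>i. \<Phi> (\<lambda>k. b k i)) \<le> int (\<lambda>i. \<Phi> (\<lambda>k. a k i) + ?r i)"
    by (intro chint_mono unif_simple_add ua ub r(1)) (drule close, linarith)
  ultimately show ?thesis
    using chint_add[OF ua r(1)] chint_add[OF ub r(1)] r(2) by simp
qed

lemma lip_map_null:
  assumes V: "finite V" and a: "\<And>k. k \<in> V \<Longrightarrow> meas (a k)" and b: "\<And>k. k \<in> V \<Longrightarrow> meas (b k)"
    and null: "\<And>k. k \<in> V \<Longrightarrow> int (\<lambda>i. d (a k i) (b k i)) = 0"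
    and \<tau>: "lip_map V \<tau>"
  shows "int (\<lambda>i. d (\<tau> (\<lambda>k. a k i)) (\<tau> (\<lambda>k. b k i))) = 0"
proof -
  obtain K where K: "K \<ge> 0" "\<And>v w. v \<in> V \<rightarrow> car \<Longrightarrow> w \<in> V \<rightarrow> car \<Longrightarrow> d (\<tau> v) (\<tau> w) \<le> K * vdist V v w"
    using \<tau> unfolding lip_map_def by blast
  let ?r = "\<lambda>i. K * vdist V (\<lambda>k. a k i) (\<lambda>k. b k i)"
  have r: "unif_simple ?r" "int ?r = 0"
    using chint_vdist_null[of V a b K, OF V a b null] by auto
  have u: "unif_simple (\<lambda>i. d (\<tau> (\<lambda>k. a k i)) (\<tau> (\<lambda>k. b k i)))"
    by (intro unif_simple_dist lip_map_meas[OF V a \<tau>] lip_map_meas[OF V b \<tau>])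
  have "int (\<lambda>i. d (\<tau> (\<lambda>k. a k i)) (\<tau> (\<lambda>k. b k i))) \<le>
      int (\<lambda>i. K * vdist V (\<lambda>k. a k i) (\<lambda>k. b k i))"
    using a b by (intro chint_mono u r(1) K) (auto intro: meas_closed)
  moreover have "int (\<lambda>i. 0) \<le> int (\<lambda>i. d (\<tau> (\<lambda>k. a k i)) (\<tau> (\<lambda>k. b k i)))"
    by (intro chint_mono u unif_simple_const) simp
  ultimately show ?thesis using r(2) chint_const[of 0] by linarith
qed

text \<open>Replacing the pair (a, c) by (b, c) changes each coordinate by integral distance 0.
  Applied to all c, this identifies the classes of a and b as sets.\<close>

lemma null_subst:
  assumes "meas a" "meas b" "meas c" "int (\<lambda>i. d (a i) (b i)) = 0"
  shows "int (\<lambda>i. d (a i) (c i)) = int (\<lambda>i. d (b i) (c i))"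
proof -
  have cc: "int (\<lambda>i. d (c i) (c i)) = 0"
    using chint_cong[of "\<lambda>i. d (c i) (c i)" "\<lambda>i. 0"] meas_closed[OF assms(3)] by (simp add: chint_const)
  let ?p = "\<lambda>k :: nat. if k = 0 then a else c" and ?q = "\<lambda>k :: nat. if k = 0 then b else c"
  have "int (\<lambda>i. d (?p 0 i) (?p 1 i)) = int (\<lambda>i. d (?q 0 i) (?q 1 i))"
  proof (rule lip_val_null_eq[OF _ _ _ _ lip_val_dist, of ?p ?q])
    fix k :: nat
    show "meas (?p k)" "meas (?q k)" using assms by simp_all
    show "int (\<lambda>i. d (?p k i) (?q k i)) = 0" using assms(4) cc by (cases "k = 0") simp_all
  qed simp
  then show ?thesis by simp
qed

lemma cls_eqI:
  assumes "meas a" "meas b" "int (\<lambda>i. d (a i) (b i)) = 0"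
  shows "cls a = cls b"
  using null_subst[OF assms(1,2) _ assms(3)] by (auto simp: mcls_def)

lemma rep_cls:
  assumes a: "meas a"
  shows "meas (rep (cls a))" "int (\<lambda>i. d (a i) (rep (cls a) i)) = 0"
proof -
  have "int (\<lambda>i. d (a i) (a i)) = 0"
    using chint_cong[of "\<lambda>i. d (a i) (a i)" "\<lambda>i. 0"] meas_closed[OF a] by (simp add: chint_const)
  then have "a \<in> cls a" using a by (simp add: mcls_def)
  then have "rep (cls a) \<in> cls a" unfolding rep_def by (metis someI_ex)
  then show "meas (rep (cls a))" "int (\<lambda>i. d (a i) (rep (cls a) i)) = 0" by (simp_all add: mcls_def)
qed

lemma lip_val_rep:
  assumes V: "finite V" and a: "\<And>k. k \<in> V \<Longrightarrow> meas (a k)" and \<Phi>: "lip_val V \<Phi>"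
  shows "int (\<lambda>i. \<Phi> (\<lambda>k. rep (cls (a k)) i)) = int (\<lambda>i. \<Phi> (\<lambda>k. a k i))"
  by (rule lip_val_null_eq[symmetric, OF V a _ _ \<Phi>]) (use a rep_cls in auto)

lemma lip_map_rep:
  assumes V: "finite V" and a: "\<And>k. k \<in> V \<Longrightarrow> meas (a k)" and \<tau>: "lip_map V \<tau>"
  shows "cls (\<lambda>i. \<tau> (\<lambda>k. rep (cls (a k)) i)) = cls (\<lambda>i. \<tau> (\<lambda>k. a k i))"
proof (rule cls_eqI[symmetric])
  show "meas (\<lambda>i. \<tau> (\<lambda>k. a k i))" by (rule lip_map_meas[OF V a \<tau>])
  show "meas (\<lambda>i. \<tau> (\<lambda>k. rep (cls (a k)) i))" by (rule lip_map_meas[OF V rep_cls(1)[OF a] \<tau>])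
  show "int (\<lambda>i. d (\<tau> (\<lambda>k. a k i)) (\<tau> (\<lambda>k. rep (cls (a k)) i))) = 0"
    by (rule lip_map_null[OF V a rep_cls(1)[OF a] rep_cls(2)[OF a] \<tau>])
qed

section \<open>Symbols and terms in the power structure\<close>

lemma tdist_map_upt: "tdist d (map v [0..<n]) (map w [0..<n]) = vdist {..<n} v w"
  by (simp add: tdist_def vdist_def)

text \<open>Lipschitz constants of a language are arbitrary reals, whereas \<open>lip_map\<close>
  and \<open>lip_val\<close> require a nonnegative constant.\<close>

lemma mult_abs_vdist: "x \<le> c * vdist V v w \<Longrightarrow> x \<le> \<bar>c\<bar> * vdist V v w"
  using mult_right_mono[OF abs_ge_self[of c] vdist_nonneg[of V v w]] by linarith

lemma lip_map_sfun: "lip_map {..<farity L F} (\<lambda>v. sfun M F (map v [0..<farity L F]))"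
  unfolding lip_map_def
proof (intro conjI ballI exI[of _ "\<bar>flip L F\<bar>"])
  fix v w assume vw: "v \<in> {..<farity L F} \<rightarrow> car" "w \<in> {..<farity L F} \<rightarrow> car"
  then show "sfun M F (map v [0..<farity L F]) \<in> car" by (intro sfun_closed) auto
  show "d (sfun M F (map v [0..<farity L F])) (sfun M F (map w [0..<farity L F]))
      \<le> \<bar>flip L F\<bar> * vdist {..<farity L F} v w"
    using vw by (intro mult_abs_vdist) (auto simp: Pi_iff simp flip: tdist_map_upt intro!: sfun_lip)
qed (auto intro!: sfun_closed)

lemma lip_val_srel: "lip_val {..<rarity L R} (\<lambda>v. srel M R (map v [0..<rarity L R]))"
  unfolding lip_val_def
proof (intro conjI ballI exI[of _ "\<bar>rlip L R\<bar>"])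
  fix v w assume vw: "v \<in> {..<rarity L R} \<rightarrow> car" "w \<in> {..<rarity L R} \<rightarrow> car"
  show "\<bar>srel M R (map v [0..<rarity L R]) - srel M R (map w [0..<rarity L R])\<bar>
      \<le> \<bar>rlip L R\<bar> * vdist {..<rarity L R} v w"
    using vw by (intro mult_abs_vdist) (auto simp: Pi_iff simp flip: tdist_map_upt intro!: srel_lip)
qed simp

text \<open>Turns a list of arguments into a tuple indexed by positions, the form in which the
  composition and representative lemmas apply.\<close>

lemma map_as_upt: "length ts = n \<Longrightarrow> map g ts = map (\<lambda>j. g (ts ! j)) [0..<n]"
  by (auto intro: nth_equalityI)

lemma lip_map_term:
  "finite V \<Longrightarrow> wf_trm L t \<Longrightarrow> fv_trm t \<subseteq> V \<Longrightarrow> lip_map V (teval M t)"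
proof (induction t)
  case (TVar k)
  then show ?case by (simp add: lip_map_proj)
next
  case (TFun F ts)
  have len: "length ts = farity L F" using TFun.prems by simp
  have "lip_map V (\<lambda>v. sfun M F (map (\<lambda>j. teval M (ts ! j) v) [0..<farity L F]))"
    by (rule lip_map_comp[OF _ lip_map_sfun]) (use TFun len in \<open>auto intro!: TFun.IH simp: UN_subset_iff\<close>)
  moreover have "teval M (TFun F ts) = (\<lambda>v. sfun M F (map (\<lambda>j. teval M (ts ! j) v) [0..<farity L F]))"
    by (rule ext) (simp add: map_as_upt[OF len])
  ultimately show ?case by simp
qed

abbreviation N :: "(('i \<Rightarrow> 'a) set, 'f, 'r) struc" where "N \<equiv> power_struc I A \<mu> M"

text \<open>At a function symbol the power structure works with representatives of the classes of
  the subterms; \<open>lip_map_rep\<close> exchanges them for the pointwise values.\<close>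

lemma teval_power:
  assumes V: "finite V" and a: "\<And>k. k \<in> V \<Longrightarrow> meas (a k)"
  shows "wf_trm L t \<Longrightarrow> fv_trm t \<subseteq> V \<Longrightarrow>
    teval N t (\<lambda>k. cls (a k)) = cls (\<lambda>i. teval M t (\<lambda>k. a k i))"
proof (induction t)
  case (TVar k)
  then show ?case by simp
next
  case (TFun F ts)
  have len: "length ts = farity L F" using TFun.prems by simp
  have ts: "wf_trm L t" "fv_trm t \<subseteq> V" if "t \<in> set ts" for t
    using TFun.prems that by auto
  let ?b = "\<lambda>j i. teval M (ts ! j) (\<lambda>k. a k i)"
  have b: "meas (?b j)" if "j \<in> {..<farity L F}" for j
    using that len ts by (intro lip_map_meas[OF V a lip_map_term[OF V]]) auto
  have "teval N (TFun F ts) (\<lambda>k. cls (a k)) =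
      cls (\<lambda>i. sfun M F (map (\<lambda>X. rep X i) (map (\<lambda>t. cls (\<lambda>i. teval M t (\<lambda>k. a k i))) ts)))"
    using TFun.IH ts by (simp add: power_struc_def cong: map_cong)
  also have "\<dots> = cls (\<lambda>i. sfun M F (map (\<lambda>j. rep (cls (?b j)) i) [0..<farity L F]))"
    by (simp add: map_as_upt[OF len] comp_def)
  also have "\<dots> = cls (\<lambda>i. sfun M F (map (\<lambda>j. ?b j i) [0..<farity L F]))"
    by (rule lip_map_rep[OF _ b lip_map_sfun]) auto
  also have "\<dots> = cls (\<lambda>i. teval M (TFun F ts) (\<lambda>k. a k i))"
    by (simp add: map_as_upt[OF len])
  finally show ?case .
qed

section \<open>Suprema and measurable selection\<close>

lemma fun_upd_Pi: "v \<in> V \<rightarrow> car \<Longrightarrow> c \<in> car \<Longrightarrow> v(x := c) \<in> insert x V \<rightarrow> car"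
  by auto

lemma SUP_upper_lip:
  assumes \<Phi>: "lip_val (insert x V) \<Phi>" and v: "v \<in> V \<rightarrow> car" and c: "c \<in> car"
  shows "\<Phi> (v(x := c)) \<le> (SUP c\<in>car. \<Phi> (v(x := c)))"
proof -
  obtain C where C: "\<And>v. v \<in> insert x V \<rightarrow> car \<Longrightarrow> \<bar>\<Phi> v\<bar> \<le> C" using lip_val_bounded[OF \<Phi>] by blast
  have "bdd_above ((\<lambda>c. \<Phi> (v(x := c))) ` car)"
    by (rule bdd_aboveI2[where M = C]) (use C fun_upd_Pi[OF v] in \<open>meson abs_le_D1\<close>)
  then show ?thesis using c by (rule cSUP_upper2) simp
qed

text \<open>The functions obtained by fixing c share the constant K, so their supremum keeps it. The
  variable x may also lie in V, where its old value is overridden.\<close>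

lemma lip_val_SUP:
  assumes V: "finite V" and \<Phi>: "lip_val (insert x V) \<Phi>"
  shows "lip_val V (\<lambda>v. SUP c\<in>car. \<Phi> (v(x := c)))"
proof -
  obtain K where K: "K \<ge> 0" "\<And>v w. v \<in> insert x V \<rightarrow> car \<Longrightarrow> w \<in> insert x V \<rightarrow> car \<Longrightarrow>
      \<bar>\<Phi> v - \<Phi> w\<bar> \<le> K * vdist (insert x V) v w"
    using \<Phi> unfolding lip_val_def by blast
  have half: "(SUP c\<in>car. \<Phi> (v(x := c))) \<le> (SUP c\<in>car. \<Phi> (w(x := c))) + K * vdist V v w"
    if v: "v \<in> V \<rightarrow> car" and w: "w \<in> V \<rightarrow> car" for v w
  proof (rule cSUP_least[OF car_nonempty])
    fix c assume c: "c \<in> car"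
    have "\<bar>\<Phi> (v(x := c)) - \<Phi> (w(x := c))\<bar> \<le> K * vdist (insert x V) (v(x := c)) (w(x := c))"
      by (intro K fun_upd_Pi v w c)
    also have "\<dots> \<le> K * vdist V v w" using K(1) by (intro mult_left_mono vdist_update V c)
    finally show "\<Phi> (v(x := c)) \<le> (SUP c\<in>car. \<Phi> (w(x := c))) + K * vdist V v w"
      using SUP_upper_lip[OF \<Phi> w c] by linarith
  qed
  have sym: "vdist V w v = vdist V v w" for v w by (simp add: vdist_def ms.commute)
  show ?thesis
    unfolding lip_val_def
  proof (intro exI[of _ K] conjI ballI)
    fix v w assume "v \<in> V \<rightarrow> car" "w \<in> V \<rightarrow> car"
    then show "\<bar>(SUP c\<in>car. \<Phi> (v(x := c))) - (SUP c\<in>car. \<Phi> (w(x := c)))\<bar> \<le> K * vdist V v w"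
      using half[of v w] half[of w v] sym[of v w] by (simp add: abs_le_iff)
  qed (rule K(1))
qed

text \<open>A near-optimal witness chosen as a function of a discrete approximation of the parameters is
  automatically measurable.\<close>

lemma measurable_selection:
  assumes V: "finite V" and a: "\<And>k. k \<in> V \<Longrightarrow> meas (a k)"
    and \<Phi>: "lip_val (insert x V) \<Phi>" and "e > 0"
  shows "\<exists>b. meas b \<and>
    (\<forall>i\<in>I. (SUP c\<in>car. \<Phi> ((\<lambda>k. a k i)(x := c))) \<le> \<Phi> ((\<lambda>k. a k i)(x := b i)) + e)"
proof -
  obtain K where K: "K \<ge> 0" "\<And>v w. v \<in> insert x V \<rightarrow> car \<Longrightarrow> w \<in> insert x V \<rightarrow> car \<Longrightarrow>
      \<bar>\<Phi> v - \<Phi> w\<bar> \<le> K * vdist (insert x V) v w"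
    using \<Phi> unfolding lip_val_def by blast
  \<comment> \<open>One third for passing from a to h, one for near-optimality of the witness at h,
    one for passing back to a.\<close>
  have "e / 3 > 0" using \<open>e > 0\<close> by simp
  note sc = scaled_pos[OF this K(1)]
  obtain h where h: "discrete_meas h" "\<And>i. i \<in> I \<Longrightarrow> h i \<in> V \<rightarrow> car"
      "\<And>i. i \<in> I \<Longrightarrow> vdist V (\<lambda>k. a k i) (h i) \<le> e / 3 / (K + 1)"
    using tuple_approx[of V a, OF V a sc(1)] by auto
  \<comment> \<open>This holds for every valuation, even one where the values are unbounded, because
    \<open>cSUP_least\<close> needs only a nonempty carrier. So s is a total function and can be
    composed with h.\<close>
  have "\<exists>c\<in>car. (SUP c\<in>car. \<Phi> (v(x := c))) - e / 3 < \<Phi> (v(x := c))" for v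
  proof (rule ccontr)
    assume "\<not> ?thesis"
    then have "(SUP c\<in>car. \<Phi> (v(x := c))) \<le> (SUP c\<in>car. \<Phi> (v(x := c))) - e / 3"
      by (intro cSUP_least[OF car_nonempty]) force
    then show False using \<open>e > 0\<close> by simp
  qed
  then obtain s where s: "\<And>v. s v \<in> car" "\<And>v. (SUP c\<in>car. \<Phi> (v(x := c))) - e / 3 < \<Phi> (v(x := s v))"
    by metis
  show ?thesis
  proof (intro exI[of _ "\<lambda>i. s (h i)"] conjI ballI)
    show "meas (\<lambda>i. s (h i))"
      using s(1) by (intro meas_of_discrete discrete_meas_comp[OF h(1)]) auto
    fix i assume i: "i \<in> I"
    have ai: "(\<lambda>k. a k i) \<in> V \<rightarrow> car" using a i by (auto intro: meas_closed)
    have close: "\<bar>\<Phi> ((\<lambda>k. a k i)(x := c)) - \<Phi> ((h i)(x := c))\<bar> \<le> e / 3" if c: "c \<in> car" for c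
    proof -
      have "\<bar>\<Phi> ((\<lambda>k. a k i)(x := c)) - \<Phi> ((h i)(x := c))\<bar>
          \<le> K * vdist (insert x V) ((\<lambda>k. a k i)(x := c)) ((h i)(x := c))"
        by (intro K fun_upd_Pi ai h(2) i c)
      also have "\<dots> \<le> K * (e / 3 / (K + 1))"
        using K(1) vdist_update[OF V c] h(3)[OF i] by (intro mult_left_mono) (auto intro: order_trans)
      finally show ?thesis using sc(2) by linarith
    qed
    show "(SUP c\<in>car. \<Phi> ((\<lambda>k. a k i)(x := c))) \<le> \<Phi> ((\<lambda>k. a k i)(x := s (h i))) + e"
    proof (rule cSUP_least[OF car_nonempty])
      fix c assume c: "c \<in> car"
      show "\<Phi> ((\<lambda>k. a k i)(x := c)) \<le> \<Phi> ((\<lambda>k. a k i)(x := s (h i))) + e"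
        using close[OF c] close[OF s(1)[of "h i"]] s(2)[of "h i"] SUP_upper_lip[OF \<Phi> h(2)[OF i] c]
        by linarith
    qed
  qed
qed

text \<open>Each b gives at most the right-hand side by monotonicity. Conversely a measurable
  selection loses at most e pointwise, hence at most e in the integral, since \<mu> has total mass
  1.\<close>

lemma SUP_chint:
  assumes V: "finite V" and a: "\<And>k. k \<in> V \<Longrightarrow> meas (a k)" and \<Phi>: "lip_val (insert x V) \<Phi>"
  shows "(SUP b\<in>{b. meas b}. int (\<lambda>i. \<Phi> ((\<lambda>k. a k i)(x := b i)))) =
    int (\<lambda>i. SUP c\<in>car. \<Phi> ((\<lambda>k. a k i)(x := c)))"
    (is "(SUP b\<in>_. ?f b) = ?g")
proof -
  have ug: "unif_simple (\<lambda>i. SUP c\<in>car. \<Phi> ((\<lambda>k. a k i)(x := c)))"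
    by (rule lip_val_unif_simple[OF V a lip_val_SUP[OF V \<Phi>]])
  have uf: "unif_simple (\<lambda>i. \<Phi> ((\<lambda>k. a k i)(x := b i)))" if "meas b" for b
  proof -
    have "unif_simple (\<lambda>i. \<Phi> (\<lambda>k. (a(x := b)) k i))"
      by (rule lip_val_unif_simple[OF _ _ \<Phi>]) (use V a that in auto)
    moreover have "(\<lambda>k. (a(x := b)) k i) = (\<lambda>k. a k i)(x := b i)" for i by auto
    ultimately show ?thesis by simp
  qed
  have le: "?f b \<le> ?g" if "meas b" for b
    using a that by (intro chint_mono uf ug SUP_upper_lip[OF \<Phi>]) (auto intro: meas_closed)
  show ?thesis
  proof (rule antisym)
    \<comment> \<open>Only the existence of some measurable map is wanted here; the error 1 is
      arbitrary.\<close>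
    obtain m where "meas m" using measurable_selection[of V a x \<Phi> 1, OF V a \<Phi>] by auto
    then show "(SUP b\<in>{b. meas b}. ?f b) \<le> ?g" using le by (intro cSUP_least) auto
    show "?g \<le> (SUP b\<in>{b. meas b}. ?f b)"
    proof (rule field_le_epsilon)
      fix e :: real assume "e > 0"
      then obtain b where b: "meas b"
        "\<And>i. i \<in> I \<Longrightarrow> (SUP c\<in>car. \<Phi> ((\<lambda>k. a k i)(x := c))) \<le> \<Phi> ((\<lambda>k. a k i)(x := b i)) + e"
        using measurable_selection[of V a x \<Phi> e, OF V a \<Phi>] by auto
      have "?g \<le> int (\<lambda>i. \<Phi> ((\<lambda>k. a k i)(x := b i)) + e)"
        by (intro chint_mono ug unif_simple_add uf unif_simple_const b)
      also have "\<dots> = ?f b + e"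
        by (simp add: chint_add[OF uf[OF b(1)] unif_simple_const] chint_const)
      also have "?f b \<le> (SUP b\<in>{b. meas b}. ?f b)"
        using le b(1) by (intro cSUP_upper bdd_aboveI2[where M = ?g]) auto
      finally show "?g \<le> (SUP b\<in>{b. meas b}. ?f b) + e" by simp
    qed
  qed
qed

section \<open>Induction on formulas\<close>

text \<open>V ranges over all finite sets containing the free variables, so that both parts of a sum
  can use the same V and a quantifier can pass to \<open>insert x V\<close>. The Lipschitz property
  is carried along because integrability and selection at the later steps rest on it.\<close>

definition los :: "('f, 'r) afm \<Rightarrow> bool" where
  "los \<phi> \<longleftrightarrow> (\<forall>V. finite V \<longrightarrow> fv_afm \<phi> \<subseteq> V \<longrightarrow> lip_val V (aeval M \<phi>) \<and>
     (\<forall>a. (\<forall>k\<in>V. meas (a k)) \<longrightarrow>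
        aeval N \<phi> (\<lambda>k. cls (a k)) = int (\<lambda>i. aeval M \<phi> (\<lambda>k. a k i))))"

lemma losI:
  assumes "\<And>V. finite V \<Longrightarrow> fv_afm \<phi> \<subseteq> V \<Longrightarrow> lip_val V (aeval M \<phi>)"
    and "\<And>V a. finite V \<Longrightarrow> fv_afm \<phi> \<subseteq> V \<Longrightarrow> (\<And>k. k \<in> V \<Longrightarrow> meas (a k)) \<Longrightarrow>
      aeval N \<phi> (\<lambda>k. cls (a k)) = int (\<lambda>i. aeval M \<phi> (\<lambda>k. a k i))"
  shows "los \<phi>"
  using assms unfolding los_def by blast

lemma losD:
  assumes "los \<phi>" "finite V" "fv_afm \<phi> \<subseteq> V"
  shows "lip_val V (aeval M \<phi>)"
    "(\<And>k. k \<in> V \<Longrightarrow> meas (a k)) \<Longrightarrow>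
      aeval N \<phi> (\<lambda>k. cls (a k)) = int (\<lambda>i. aeval M \<phi> (\<lambda>k. a k i))"
  using assms unfolding los_def by blast+

lemma los_unif_simple:
  assumes "los \<phi>" "finite V" "fv_afm \<phi> \<subseteq> V" "\<And>k. k \<in> V \<Longrightarrow> meas (a k)"
  shows "unif_simple (\<lambda>i. aeval M \<phi> (\<lambda>k. a k i))"
  by (rule lip_val_unif_simple[OF assms(2,4) losD(1)[OF assms(1-3)]])

lemma los_One: "los AOne"
proof (rule losI)
  fix V
  have "lip_val V (\<lambda>v. 1)" by (auto simp: lip_val_def)
  moreover have "aeval M AOne = (\<lambda>v. 1)" by (rule ext) simp
  ultimately show "lip_val V (aeval M AOne)" by simp
qed (simp add: chint_const)

lemma los_Dist:
  assumes s: "wf_trm L s" and t: "wf_trm L t"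
  shows "los (ADist s t)"
proof (rule losI)
  fix V assume V: "finite V" and fv: "fv_afm (ADist s t) \<subseteq> V"
  have ls: "lip_map V (teval M s)" and lt: "lip_map V (teval M t)"
    using V fv s t by (auto intro: lip_map_term)
  have "lip_val V (\<lambda>v. d (teval M s v) (teval M t v))"
    using lip_val_comp[OF _ lip_val_dist, of V "\<lambda>j. if j = 0 then teval M s else teval M t"] ls lt by simp
  moreover have "aeval M (ADist s t) = (\<lambda>v. d (teval M s v) (teval M t v))" by (rule ext) simp
  ultimately show "lip_val V (aeval M (ADist s t))" by simp
  fix a assume a: "\<And>k. k \<in> V \<Longrightarrow> meas (a k)"
  let ?s = "\<lambda>i. teval M s (\<lambda>k. a k i)" and ?t = "\<lambda>i. teval M t (\<lambda>k. a k i)"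
  have "meas ?s" "meas ?t" by (rule lip_map_meas[OF V a ls], assumption, rule lip_map_meas[OF V a lt])
  then have "int (\<lambda>i. d (rep (cls ?s) i) (rep (cls ?t) i)) = int (\<lambda>i. d (?s i) (?t i))"
    using lip_val_rep[OF _ _ lip_val_dist, of "\<lambda>j. if j = 0 then ?s else ?t"] by simp
  moreover have "teval N s (\<lambda>k. cls (a k)) = cls ?s" "teval N t (\<lambda>k. cls (a k)) = cls ?t"
    using teval_power[of V a, OF V a] fv s t by auto
  ultimately show "aeval N (ADist s t) (\<lambda>k. cls (a k)) = int (\<lambda>i. aeval M (ADist s t) (\<lambda>k. a k i))"
    by (simp add: power_struc_def)
qed

lemma los_Rel:
  assumes wf: "wf_afm L (ARel R ts)"
  shows "los (ARel R ts)"
proof (rule losI)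
  fix V assume V: "finite V" and fv: "fv_afm (ARel R ts) \<subseteq> V"
  have len: "length ts = rarity L R" using wf by simp
  have ts: "wf_trm L t" "fv_trm t \<subseteq> V" if "t \<in> set ts" for t
    using wf fv that by auto
  have lt: "lip_map V (teval M (ts ! j))" if "j \<in> {..<rarity L R}" for j
    using that len ts by (intro lip_map_term[OF V]) auto
  have "lip_val V (\<lambda>v. srel M R (map (\<lambda>j. teval M (ts ! j) v) [0..<rarity L R]))"
    by (rule lip_val_comp[OF _ lip_val_srel lt]) auto
  moreover have "aeval M (ARel R ts) = (\<lambda>v. srel M R (map (\<lambda>j. teval M (ts ! j) v) [0..<rarity L R]))"
    by (rule ext) (simp add: map_as_upt[OF len])
  ultimately show "lip_val V (aeval M (ARel R ts))" by simp
  fix a assume a: "\<And>k. k \<in> V \<Longrightarrow> meas (a k)"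
  let ?b = "\<lambda>j i. teval M (ts ! j) (\<lambda>k. a k i)"
  have b: "meas (?b j)" if "j \<in> {..<rarity L R}" for j
    by (rule lip_map_meas[OF V a lt[OF that]])
  have "aeval N (ARel R ts) (\<lambda>k. cls (a k)) =
      int (\<lambda>i. srel M R (map (\<lambda>X. rep X i) (map (\<lambda>t. cls (\<lambda>i. teval M t (\<lambda>k. a k i))) ts)))"
    using teval_power[OF V a] ts by (simp add: power_struc_def cong: map_cong)
  also have "\<dots> = int (\<lambda>i. srel M R (map (\<lambda>j. rep (cls (?b j)) i) [0..<rarity L R]))"
    by (simp add: map_as_upt[OF len] comp_def)
  also have "\<dots> = int (\<lambda>i. srel M R (map (\<lambda>j. ?b j i) [0..<rarity L R]))"
    by (rule lip_val_rep[OF _ b lip_val_srel]) auto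
  also have "\<dots> = int (\<lambda>i. aeval M (ARel R ts) (\<lambda>k. a k i))"
    by (simp add: map_as_upt[OF len])
  finally show "aeval N (ARel R ts) (\<lambda>k. cls (a k)) = int (\<lambda>i. aeval M (ARel R ts) (\<lambda>k. a k i))" .
qed

lemma lip_val_add:
  assumes "lip_val V \<Phi>" "lip_val V \<Psi>"
  shows "lip_val V (\<lambda>v. \<Phi> v + \<Psi> v)"
proof -
  obtain K K' where K: "K \<ge> 0" "\<And>v w. v \<in> V \<rightarrow> car \<Longrightarrow> w \<in> V \<rightarrow> car \<Longrightarrow> \<bar>\<Phi> v - \<Phi> w\<bar> \<le> K * vdist V v w"
    and K': "K' \<ge> 0" "\<And>v w. v \<in> V \<rightarrow> car \<Longrightarrow> w \<in> V \<rightarrow> car \<Longrightarrow> \<bar>\<Psi> v - \<Psi> w\<bar> \<le> K' * vdist V v w"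
    using assms unfolding lip_val_def by metis
  have "\<bar>\<Phi> v + \<Psi> v - (\<Phi> w + \<Psi> w)\<bar> \<le> (K + K') * vdist V v w" if "v \<in> V \<rightarrow> car" "w \<in> V \<rightarrow> car" for v w
    using K(2)[OF that] K'(2)[OF that] by (simp add: distrib_right)
  then show ?thesis unfolding lip_val_def using K(1) K'(1) by (intro exI[of _ "K + K'"]) auto
qed

lemma lip_val_cmult:
  assumes "lip_val V \<Phi>"
  shows "lip_val V (\<lambda>v. c * \<Phi> v)"
proof -
  obtain K where K: "K \<ge> 0" "\<And>v w. v \<in> V \<rightarrow> car \<Longrightarrow> w \<in> V \<rightarrow> car \<Longrightarrow> \<bar>\<Phi> v - \<Phi> w\<bar> \<le> K * vdist V v w"
    using assms unfolding lip_val_def by metis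
  have "\<bar>c * \<Phi> v - c * \<Phi> w\<bar> \<le> (\<bar>c\<bar> * K) * vdist V v w" if "v \<in> V \<rightarrow> car" "w \<in> V \<rightarrow> car" for v w
    using mult_left_mono[OF K(2)[OF that], of "\<bar>c\<bar>"]
    by (simp add: abs_mult mult.assoc flip: right_diff_distrib)
  then show ?thesis unfolding lip_val_def using K(1) by (intro exI[of _ "\<bar>c\<bar> * K"]) auto
qed

lemma los_Add:
  assumes p: "los p" and q: "los q"
  shows "los (AAdd p q)"
proof (rule losI)
  fix V assume V: "finite V" and "fv_afm (AAdd p q) \<subseteq> V"
  then have fv: "fv_afm p \<subseteq> V" "fv_afm q \<subseteq> V" by auto
  have "aeval M (AAdd p q) = (\<lambda>v. aeval M p v + aeval M q v)" by (rule ext) simp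
  then show "lip_val V (aeval M (AAdd p q))"
    using lip_val_add[OF losD(1)[OF p V fv(1)] losD(1)[OF q V fv(2)]] by simp
  fix a assume a: "\<And>k. k \<in> V \<Longrightarrow> meas (a k)"
  show "aeval N (AAdd p q) (\<lambda>k. cls (a k)) = int (\<lambda>i. aeval M (AAdd p q) (\<lambda>k. a k i))"
    using losD(2)[OF p V fv(1) a] losD(2)[OF q V fv(2) a]
      chint_add[OF los_unif_simple[OF p V fv(1) a] los_unif_simple[OF q V fv(2) a]] by simp
qed

lemma los_Scale:
  assumes p: "los p"
  shows "los (AScale c p)"
proof (rule losI)
  fix V assume V: "finite V" and "fv_afm (AScale c p) \<subseteq> V"
  then have fv: "fv_afm p \<subseteq> V" by auto
  have "aeval M (AScale c p) = (\<lambda>v. c * aeval M p v)" by (rule ext) simp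
  then show "lip_val V (aeval M (AScale c p))"
    using lip_val_cmult[OF losD(1)[OF p V fv]] by simp
  fix a assume a: "\<And>k. k \<in> V \<Longrightarrow> meas (a k)"
  show "aeval N (AScale c p) (\<lambda>k. cls (a k)) = int (\<lambda>i. aeval M (AScale c p) (\<lambda>k. a k i))"
    using losD(2)[OF p V fv a] chint_cmult[OF los_unif_simple[OF p V fv a]] by simp
qed

lemma los_Sup:
  assumes p: "los p"
  shows "los (ASup x p)"
proof (rule losI)
  fix V assume V: "finite V" and "fv_afm (ASup x p) \<subseteq> V"
  then have V': "finite (insert x V)" and fv: "fv_afm p \<subseteq> insert x V" by auto
  note lip = losD(1)[OF p V' fv]
  have "aeval M (ASup x p) = (\<lambda>v. SUP c\<in>car. aeval M p (v(x := c)))" by (rule ext) simp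
  then show "lip_val V (aeval M (ASup x p))"
    using lip_val_SUP[OF V lip] by simp
  fix a assume a: "\<And>k. k \<in> V \<Longrightarrow> meas (a k)"
  \<comment> \<open>This turns the supremum over classes into one over measurable maps, the form
    treated by \<open>SUP_chint\<close>.\<close>
  have car_N: "scarrier N = cls ` {b. meas b}" by (auto simp: power_struc_def)
  have "aeval N p ((\<lambda>k. cls (a k))(x := cls b)) =
      int (\<lambda>i. aeval M p ((\<lambda>k. a k i)(x := b i)))" if b: "meas b" for b
  proof -
    have "aeval N p (\<lambda>k. cls ((a(x := b)) k)) = int (\<lambda>i. aeval M p (\<lambda>k. (a(x := b)) k i))"
      by (rule losD(2)[OF p V' fv]) (use a b in auto)
    moreover have "(\<lambda>k. cls ((a(x := b)) k)) = (\<lambda>k. cls (a k))(x := cls b)"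
      by (simp add: fun_eq_iff)
    moreover have "(\<lambda>k. (a(x := b)) k i) = (\<lambda>k. a k i)(x := b i)" for i by auto
    ultimately show ?thesis by simp
  qed
  then have "aeval N (ASup x p) (\<lambda>k. cls (a k)) =
      (SUP b\<in>{b. meas b}. int (\<lambda>i. aeval M p ((\<lambda>k. a k i)(x := b i))))"
    unfolding aeval.simps car_N image_image by (intro SUP_cong refl) simp
  also have "\<dots> = int (\<lambda>i. aeval M (ASup x p) (\<lambda>k. a k i))"
    using SUP_chint[OF V a lip] by simp
  finally show "aeval N (ASup x p) (\<lambda>k. cls (a k)) = int (\<lambda>i. aeval M (ASup x p) (\<lambda>k. a k i))" .
qed

text \<open>\<open>Inf\<close> on the reals is defined by negating \<open>Sup\<close> of the negated
  set, so the two formulas agree in every structure and at every valuation.\<close>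

lemma aeval_Inf: "aeval S (AInf x p) = aeval S (AScale (- 1) (ASup x (AScale (- 1) p)))"
  by (rule ext) (simp add: Inf_real_def image_image)

lemma los_Inf:
  assumes "los p"
  shows "los (AInf x p)"
proof -
  have "los (AScale (- 1) (ASup x (AScale (- 1) p)))" by (intro los_Scale los_Sup assms)
  then show ?thesis unfolding los_def aeval_Inf by simp
qed

lemma los_afm: "wf_afm L \<phi> \<Longrightarrow> los \<phi>"
  by (induction \<phi>) (auto intro: los_One los_Dist los_Rel los_Add los_Scale los_Sup los_Inf)

end

theorem mainTheorem10:
  fixes L :: "('f, 'r) lang"
    and M :: "('a, 'f, 'r) struc"
    and I :: "'i set" and A :: "'i set set" and \<mu> :: "'i set \<Rightarrow> real"
    and \<phi> :: "('f, 'r) afm" and n :: nat and a :: "nat \<Rightarrow> 'i \<Rightarrow> 'a"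
  assumes "charge_space I A \<mu>"
    and "is_Lstructure L M"
    and "meanable A M"
    and "wf_afm L \<phi>"
    and "fv_afm \<phi> \<subseteq> {..<n}"
    and "\<forall>k<n. meas_map I A M (a k)"
  shows "aeval (power_struc I A \<mu> M) \<phi> (\<lambda>k. mcls I A \<mu> M (a k))
         = chint I A \<mu> (\<lambda>i. aeval M \<phi> (\<lambda>k. a k i))"
proof -
  interpret mean I A \<mu> L M
    using assms(1-3) by unfold_locales
  show ?thesis
    using losD(2)[OF los_afm[OF assms(4)] finite_lessThan assms(5), of a] assms(6) by simp
qed

end
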